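(* Let $m\ge n$, let $X$ and $Y$ be smooth manifolds of dimensions $m$ and $n$, and let $c\in C^4(\overline X\times\overline Y)$ be such that $D^2_{xy}c(x,y):T_yY\to T_x^*X$ is injective for all $x\in X$, $y\in Y$. (i) $Y$ looks $c$-linear from $x\in X$ if and only if $T_x(L_x(y))$ is independent of $y$; that is, $T_x(L_x(y_0))=T_x(L_x(y_1))$ for all $y_0,y_1\in Y$. (ii) If the level sets $L_x(y)$ are all connected, then $Y$ is $c$-linear with respect to $X$ if and only if $L_x(y)$ is independent of $y$ for all $x$.
   Context: $X$ and $Y$ may be smoothly embedded in larger manifolds in which their closures $\overline X,\overline Y$ are compact. $D_xc(x,y)\in T_x^*X$ and $D_yc(x,y)\in T_y^*Y$ denote the differentials of $c$ with respect to $x$ and $y$. $D^2_{xy}c(x,y):T_yY\to T^*_xX$ is the linear map given in local coordinates by $\frac{\partial}{\partial y^i}\mapsto \frac{\partial^2c(x,y)}{\partial y^i\partial x^j}dx^j$ (summation over $j$). For $x\in X$, $y\in Y$, $L_x(y):=\{\overline x\in X: D_yc(\overline x,y)=D_yc(x,y)\}$. Under the injectivity assumption on $D^2_{xy}c$ it is a smooth $(m-n)$-dimensional submanifold of $X$, and $T_x(L_x(y))$ is its tangent space at $x$. $Y$ looks $c$-linear from $x\in X$ if $D_xc(x,Y)=\{D_xc(x,y):y\in Y\}$ is contained in an $n$-dimensional linear subspace of $T_x^*X$. $Y$ is $c$-linear with respect to $X$ if it looks $c$-linear from every $x\in X$.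
   Formalization: "n-dimensional linear subspace" is read as a translate of one (an affine flat), since c = x1*y + x2 refutes the literal equivalence, and Y is assumed connected, since the "if" directions fail for disconnected Y. *)

theory Defs
  imports "HOL-Analysis.Analysis"
begin

text \<open>\<open>f\<close> is of class \<open>C\<^sup>k\<close> on \<open>S\<close>, where \<open>S\<close> is meant to be open.\<close>

fun Ck_on :: "nat \<Rightarrow> 'e::euclidean_space set \<Rightarrow> ('e \<Rightarrow> 'g::real_normed_vector) \<Rightarrow> bool" where
  "Ck_on 0 S f \<longleftrightarrow> continuous_on S f"
| "Ck_on (Suc k) S f \<longleftrightarrow>
     (\<forall>u\<in>S. f differentiable (at u)) \<and> (\<forall>v. Ck_on k S (\<lambda>u. frechet_derivative f (at u) v))"

definition smooth_on :: "'e::euclidean_space set \<Rightarrow> ('e \<Rightarrow> 'g::real_normed_vector) \<Rightarrow> bool" where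
  "smooth_on S f \<longleftrightarrow> (\<forall>k. Ck_on k S f)"

text \<open>A chart is a domain together with a coordinate map (whose values outside the domain are
  irrelevant). The dimension of a manifold is that of the model space \<open>'e\<close>.\<close>

type_synonym ('a, 'e) chart = "'a set \<times> ('a \<Rightarrow> 'e)"

text \<open>\<open>A\<close> is a smooth atlas on the set \<open>M\<close>, which carries the subspace topology.
  The Hausdorff property and second countability are imposed through the type class of \<open>'a\<close>;
  both are inherited by subspaces.\<close>

definition smooth_manifold ::
    "'a::{t2_space, second_countable_topology} set \<Rightarrow> ('a, 'e::euclidean_space) chart set \<Rightarrow> bool" where
  "smooth_manifold M A \<longleftrightarrow>
     (\<Union>(U, \<phi>)\<in>A. U) = M \<and>
     (\<forall>(U, \<phi>)\<in>A. openin (top_of_set M) U \<and> open (\<phi> ` U) \<and>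
        homeomorphism U (\<phi> ` U) \<phi> (inv_into U \<phi>)) \<and>
     (\<forall>(U, \<phi>)\<in>A. \<forall>(V, \<psi>)\<in>A. smooth_on (\<phi> ` (U \<inter> V)) (\<psi> \<circ> inv_into U \<phi>))"

text \<open>The inclusion of the manifold with atlas \<open>A\<close> into the manifold with atlas \<open>B\<close> is a smooth
  immersion. As the charts in \<open>A\<close> are homeomorphisms for the subspace topology,
  the inclusion is then a smooth embedding.\<close>

definition smoothly_embedded ::
    "('a, 'e::euclidean_space) chart set \<Rightarrow> ('a, 'p::euclidean_space) chart set \<Rightarrow> bool" where
  "smoothly_embedded A B \<longleftrightarrow>
     (\<forall>(U, \<phi>)\<in>A. \<forall>(V, \<psi>)\<in>B.
        smooth_on (\<phi> ` (U \<inter> V)) (\<psi> \<circ> inv_into U \<phi>) \<and>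
        (\<forall>u \<in> \<phi> ` (U \<inter> V). inj (frechet_derivative (\<psi> \<circ> inv_into U \<phi>) (at u))))"

text \<open>\<open>c \<in> C\<^sup>k(S \<times> T)\<close> for arbitrary subsets \<open>S\<close> and \<open>T\<close> of the manifolds with atlases \<open>A\<close> and \<open>B\<close>:
  near each point of \<open>S \<times> T\<close>, \<open>c\<close> has a \<open>C\<^sup>k\<close> extension to a neighbourhood in the product
  manifold. Since \<open>c\<close> is compared with the extension only on \<open>S \<times> T\<close>, its values elsewhere
  do not matter.\<close>

definition Ck_on_product ::
    "nat \<Rightarrow> ('a, 'p::euclidean_space) chart set \<Rightarrow> ('b, 'q::euclidean_space) chart set \<Rightarrow>
     'a set \<Rightarrow> 'b set \<Rightarrow> ('a \<Rightarrow> 'b \<Rightarrow> real) \<Rightarrow> bool" where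
  "Ck_on_product k A B S T c \<longleftrightarrow>
     (\<forall>p\<in>S. \<forall>q\<in>T. \<exists>(U, \<phi>)\<in>A. \<exists>(V, \<psi>)\<in>B. p \<in> U \<and> q \<in> V \<and>
        (\<exists>W g. open W \<and> (\<phi> p, \<psi> q) \<in> W \<and> Ck_on k W g \<and>
           (\<forall>x \<in> S \<inter> U. \<forall>y \<in> T \<inter> V. (\<phi> x, \<psi> y) \<in> W \<longrightarrow> g (\<phi> x, \<psi> y) = c x y)))"

text \<open>The tangent space at \<open>x\<close> is identified with the model space \<open>'e\<close> by means of one fixed
  chart around \<open>x\<close>, and the cotangent space accordingly with \<open>'e \<Rightarrow>\<^sub>L real\<close>. Another choice
  of chart amounts to a linear change of basis, which affects none of the notions below.\<close>

definition chart_at :: "('a, 'e) chart set \<Rightarrow> 'a \<Rightarrow> ('a, 'e) chart" where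
  "chart_at A x = (SOME K. K \<in> A \<and> x \<in> fst K)"

definition differential ::
    "('a, 'e::euclidean_space) chart set \<Rightarrow> ('a \<Rightarrow> 'g::real_normed_vector) \<Rightarrow> 'a \<Rightarrow> 'e \<Rightarrow>\<^sub>L 'g" where
  "differential A f x =
     (case chart_at A x of (U, \<phi>) \<Rightarrow> Blinfun (frechet_derivative (f \<circ> inv_into U \<phi>) (at (\<phi> x))))"

definition Dx :: "('a, 'e::euclidean_space) chart set \<Rightarrow> ('a \<Rightarrow> 'b \<Rightarrow> real) \<Rightarrow> 'a \<Rightarrow> 'b \<Rightarrow> 'e \<Rightarrow>\<^sub>L real" where
  "Dx A c x y = differential A (\<lambda>x'. c x' y) x"

definition Dy :: "('b, 'f::euclidean_space) chart set \<Rightarrow> ('a \<Rightarrow> 'b \<Rightarrow> real) \<Rightarrow> 'a \<Rightarrow> 'b \<Rightarrow> 'f \<Rightarrow>\<^sub>L real" where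
  "Dy B c x y = differential B (\<lambda>y'. c x y') y"

text \<open>The differential at \<open>y\<close> of the map \<open>y' \<mapsto> D\<^sub>xc(x, y')\<close> into the fixed vector space
  \<open>T\<^sub>x\<^sup>*X\<close>; in coordinates it sends the \<open>i\<close>-th basis vector to the covector whose \<open>j\<close>-th component
  is the derivative of \<open>c\<close> with respect to \<open>x\<^sup>j\<close> and then \<open>y\<^sup>i\<close>.\<close>

definition D2xy ::
    "('a, 'e::euclidean_space) chart set \<Rightarrow> ('b, 'f::euclidean_space) chart set \<Rightarrow>
     ('a \<Rightarrow> 'b \<Rightarrow> real) \<Rightarrow> 'a \<Rightarrow> 'b \<Rightarrow> 'f \<Rightarrow>\<^sub>L ('e \<Rightarrow>\<^sub>L real)" where
  "D2xy A B c x y = differential B (\<lambda>y'. Dx A c x y') y"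

definition level_set ::
    "'a set \<Rightarrow> ('b, 'f::euclidean_space) chart set \<Rightarrow> ('a \<Rightarrow> 'b \<Rightarrow> real) \<Rightarrow> 'a \<Rightarrow> 'b \<Rightarrow> 'a set" where
  "level_set X B c x y = {x' \<in> X. Dy B c x' y = Dy B c x y}"

text \<open>The tangent space at \<open>x\<close> of a submanifold \<open>S\<close>, as a subset of the tangent space of the
  manifold with atlas \<open>A\<close>: the velocities at time 0 of the \<open>C\<^sup>1\<close> curves in \<open>S\<close> passing through \<open>x\<close>
  at time 0.\<close>

definition tangent_space ::
    "('a, 'e::euclidean_space) chart set \<Rightarrow> 'a set \<Rightarrow> 'a \<Rightarrow> 'e set" where
  "tangent_space A S x =
     (case chart_at A x of (U, \<phi>) \<Rightarrow>
        {v. \<exists>(\<gamma> :: real \<Rightarrow> 'a) \<epsilon>. \<epsilon> > 0 \<and> \<gamma> 0 = x \<and> \<gamma> ` {-\<epsilon><..<\<epsilon>} \<subseteq> S \<inter> U \<and>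
              Ck_on 1 {-\<epsilon><..<\<epsilon>} (\<phi> \<circ> \<gamma>) \<and> ((\<phi> \<circ> \<gamma>) has_vector_derivative v) (at 0)})"

text \<open>``Contained in an \<open>n\<close>-dimensional linear subspace'' is understood in the sense of flats,
  i.e. up to a translation. Subspaces through the origin would be too restrictive, since
  adding to \<open>c\<close> a function of \<open>x\<close> alone translates \<open>D\<^sub>xc(x, Y)\<close> but changes neither \<open>D\<^sup>2\<^sub>x\<^sub>yc\<close> nor
  the level sets: for \<open>c(x, y) = x\<^sub>1 y + x\<^sub>2\<close>, with \<open>m = 2\<close> and \<open>n = 1\<close>, the sets \<open>L\<^sub>x(y)\<close> are
  independent of \<open>y\<close>, but the vectors \<open>(y, 1)\<close> do not all lie on one line through the origin.\<close>

definition looks_c_linear ::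
    "('a, 'e::euclidean_space) chart set \<Rightarrow> 'b set \<Rightarrow> nat \<Rightarrow> ('a \<Rightarrow> 'b \<Rightarrow> real) \<Rightarrow> 'a \<Rightarrow> bool" where
  "looks_c_linear A Y n c x \<longleftrightarrow>
     (\<exists>p V. subspace V \<and> dim V = n \<and> Dx A c x ` Y \<subseteq> (+) p ` V)"

definition c_linear ::
    "'a set \<Rightarrow> ('a, 'e::euclidean_space) chart set \<Rightarrow> 'b set \<Rightarrow> nat \<Rightarrow> ('a \<Rightarrow> 'b \<Rightarrow> real) \<Rightarrow> bool" where
  "c_linear X A Y n c \<longleftrightarrow> (\<forall>x\<in>X. looks_c_linear A Y n c x)"

end

theory Submission
  imports Defs
begin

text \<open>For \<open>(x, y)\<close> let \<open>K(x, y)\<close> be the annihilator of the range of \<open>D\<^sup>2\<^sub>x\<^sub>yc(x, y)\<close>. By symmetry of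
  second derivatives it is the kernel of the differential at \<open>x\<close> of \<open>x' \<mapsto> D\<^sub>yc(x', y)\<close>, which is
  surjective, so \<open>T\<^sub>x(L\<^sub>x(y)) = K(x, y)\<close> by the implicit function theorem. If \<open>D\<^sub>xc(x, Y)\<close> lies in an
  \<open>n\<close>-dimensional flat, its direction must be the range of \<open>D\<^sup>2\<^sub>x\<^sub>yc(x, y)\<close> for every \<open>y\<close>, so \<open>K(x, y)\<close> is
  independent of \<open>y\<close>. Conversely, if \<open>K(x, y) = K(x)\<close>, then \<open>D\<^sub>xc(x, \<sqdot>)\<close> paired with a vector of \<open>K(x)\<close>
  has vanishing derivative and is constant on the connected \<open>Y\<close>.

  For (ii), if \<open>K(x, y0) = K(x, y1)\<close> for all \<open>x\<close>, then \<open>D\<^sub>yc(\<sqdot>, y1)\<close> has zero derivative along the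
  level sets of \<open>D\<^sub>yc(\<sqdot>, y0)\<close>; it is thus locally constant on them, and constant by connectedness.\<close>

subsection \<open>Functions of class \<open>C\<^sup>2\<close> and submersions\<close>

lemma Ck_on_imp_continuous_on:
  "Ck_on k S f \<Longrightarrow> continuous_on S f"
  by (cases k)
    (auto intro!: continuous_at_imp_continuous_on differentiable_imp_continuous_within)

lemma smooth_on_imp_continuous_on: "smooth_on S f \<Longrightarrow> continuous_on S f"
  unfolding smooth_on_def using Ck_on_imp_continuous_on by blast

text \<open>\<open>Ck_on\<close> gives continuity of each directional derivative separately. On a
  Euclidean domain this amounts to continuity of the derivative in operator norm, because finitely
  many basis directions control the norm.\<close>

lemma C1_derivative:
  fixes f :: "'e::euclidean_space \<Rightarrow> 'g::real_normed_vector"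
  assumes "Ck_on (Suc k) S f"
  obtains f' where "\<And>u. u \<in> S \<Longrightarrow> (f has_derivative blinfun_apply (f' u)) (at u)" "continuous_on S f'"
proof
  define f' where "f' u = Blinfun (frechet_derivative f (at u))" for u
  have d: "(f has_derivative frechet_derivative f (at u)) (at u)" if "u \<in> S" for u
    using assms that by (simp add: frechet_derivative_works)
  have app: "blinfun_apply (f' u) = frechet_derivative f (at u)" if "u \<in> S" for u
    unfolding f'_def by (rule bounded_linear_Blinfun_apply[OF has_derivative_bounded_linear[OF d[OF that]]])
  show "(f has_derivative blinfun_apply (f' u)) (at u)" if "u \<in> S" for u
    using d app that by simp
  show "continuous_on S f'"
  proof (rule continuous_on_blinfun_componentwise)
    show "continuous_on S (\<lambda>u. f' u i)" for i
      by (rule continuous_on_eq[of _ "\<lambda>u. frechet_derivative f (at u) i"])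
         (use assms in \<open>auto simp: app intro: Ck_on_imp_continuous_on\<close>)
  qed
qed

section \<open>Symmetry of second derivatives\<close>

text \<open>The mean value theorem is applied twice: in direction \<open>h\<close> to the increment
  of \<open>g\<close> along \<open>s *\<^sub>R k\<close>, then in direction \<open>k\<close> to the
  resulting increment of \<open>Dg\<close>.\<close>

lemma second_difference_mvt:
  fixes g :: "'z::real_normed_vector \<Rightarrow> real"
  assumes W: "ball z r \<subseteq> W" and s: "0 < s" "s * (norm h + norm k) < r"
    and g: "\<And>z. z \<in> W \<Longrightarrow> (g has_derivative blinfun_apply (Dg z)) (at z)"
    and Dg: "\<And>z. z \<in> W \<Longrightarrow> (Dg has_derivative blinfun_apply (D2g z)) (at z)"
  shows "\<exists>p\<in>ball z r. g (z + s *\<^sub>R h + s *\<^sub>R k) - g (z + s *\<^sub>R h) - g (z + s *\<^sub>R k) + g z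
           = s\<^sup>2 * D2g p k h"
proof -
  have near: "z + \<sigma> *\<^sub>R h + \<tau> *\<^sub>R k \<in> ball z r" if "\<sigma> \<in> {0..s}" "\<tau> \<in> {0..s}" for \<sigma> \<tau>
  proof -
    have "norm (\<sigma> *\<^sub>R h + \<tau> *\<^sub>R k) \<le> norm (\<sigma> *\<^sub>R h) + norm (\<tau> *\<^sub>R k)"
      by (rule norm_triangle_ineq)
    also have "\<dots> \<le> s * norm h + s * norm k"
      using that by (auto intro!: add_mono mult_right_mono)
    also have "\<dots> < r" using s(2) by (simp add: algebra_simps)
    finally show ?thesis
      by (metis ab_semigroup_add_class.add_ac(1) dist_add_cancel dist_norm mem_ball add.right_neutral dist_0_norm)
  qed
  have near1: "z + \<sigma> *\<^sub>R h \<in> ball z r" if "\<sigma> \<in> {0..s}" for \<sigma>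
    using near[OF that, of 0] s(1) by simp
  define \<phi> where "\<phi> \<sigma> = g (z + \<sigma> *\<^sub>R h + s *\<^sub>R k) - g (z + \<sigma> *\<^sub>R h)" for \<sigma>
  have "\<exists>\<sigma>\<in>{0<..<s}. \<phi> s - \<phi> 0 = (\<lambda>d. Dg (z + \<sigma> *\<^sub>R h + s *\<^sub>R k) (d *\<^sub>R h) - Dg (z + \<sigma> *\<^sub>R h) (d *\<^sub>R h)) (s - 0)"
  proof (rule mvt_simple[OF s(1)])
    fix \<sigma> :: real assume "0 \<le> \<sigma>" "\<sigma> \<le> s"
    then have "z + \<sigma> *\<^sub>R h + s *\<^sub>R k \<in> W" "z + \<sigma> *\<^sub>R h \<in> W"
      using near[of \<sigma> s] near1[of \<sigma>] W s(1) by auto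
    note d = g[OF this(1)] g[OF this(2)]
    have "((\<lambda>\<sigma>. g (z + \<sigma> *\<^sub>R h + s *\<^sub>R k)) has_derivative
            (\<lambda>d. Dg (z + \<sigma> *\<^sub>R h + s *\<^sub>R k) (d *\<^sub>R h))) (at \<sigma> within {0..s})"
      by (rule has_derivative_compose[where x=\<sigma> and g=g and f="\<lambda>\<sigma>. z + \<sigma> *\<^sub>R h + s *\<^sub>R k", OF _ d(1)]) (auto intro!: derivative_eq_intros)
    moreover have "((\<lambda>\<sigma>. g (z + \<sigma> *\<^sub>R h)) has_derivative (\<lambda>d. Dg (z + \<sigma> *\<^sub>R h) (d *\<^sub>R h)))
            (at \<sigma> within {0..s})"
      by (rule has_derivative_compose[where x=\<sigma> and g=g and f="\<lambda>\<sigma>. z + \<sigma> *\<^sub>R h", OF _ d(2)]) (auto intro!: derivative_eq_intros)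
    ultimately show "(\<phi> has_derivative (\<lambda>d. Dg (z + \<sigma> *\<^sub>R h + s *\<^sub>R k) (d *\<^sub>R h) - Dg (z + \<sigma> *\<^sub>R h) (d *\<^sub>R h)))
            (at \<sigma> within {0..s})"
      unfolding \<phi>_def
      by (rule has_derivative_diff)
  qed
  then obtain \<sigma> where \<sigma>: "\<sigma> \<in> {0<..<s}"
    and eq1: "\<phi> s - \<phi> 0 = s * (Dg (z + \<sigma> *\<^sub>R h + s *\<^sub>R k) h - Dg (z + \<sigma> *\<^sub>R h) h)"
    by (auto simp: blinfun.bilinear_simps algebra_simps)
  define \<psi> where "\<psi> \<tau> = Dg (z + \<sigma> *\<^sub>R h + \<tau> *\<^sub>R k) h" for \<tau>
  have "\<exists>\<tau>\<in>{0<..<s}. \<psi> s - \<psi> 0 = (\<lambda>d. D2g (z + \<sigma> *\<^sub>R h + \<tau> *\<^sub>R k) (d *\<^sub>R k) h) (s - 0)"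
  proof (rule mvt_simple[OF s(1)])
    fix \<tau> :: real assume "0 \<le> \<tau>" "\<tau> \<le> s"
    then have "z + \<sigma> *\<^sub>R h + \<tau> *\<^sub>R k \<in> W"
      using near[of \<sigma> \<tau>] W \<sigma> by auto
    note d = Dg[OF this]
    have "((\<lambda>\<tau>. Dg (z + \<sigma> *\<^sub>R h + \<tau> *\<^sub>R k)) has_derivative (\<lambda>d. D2g (z + \<sigma> *\<^sub>R h + \<tau> *\<^sub>R k) (d *\<^sub>R k)))
            (at \<tau> within {0..s})"
      by (rule has_derivative_compose[where x=\<tau> and g=Dg and f="\<lambda>\<tau>. z + \<sigma> *\<^sub>R h + \<tau> *\<^sub>R k", OF _ d]) (auto intro!: derivative_eq_intros)
    from bounded_linear.has_derivative[OF blinfun.bounded_linear_left[of h] this]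
    show "(\<psi> has_derivative (\<lambda>d. D2g (z + \<sigma> *\<^sub>R h + \<tau> *\<^sub>R k) (d *\<^sub>R k) h)) (at \<tau> within {0..s})"
      unfolding \<psi>_def .
  qed
  then obtain \<tau> where \<tau>: "\<tau> \<in> {0<..<s}"
    and eq2: "\<psi> s - \<psi> 0 = s * D2g (z + \<sigma> *\<^sub>R h + \<tau> *\<^sub>R k) k h"
    by (auto simp: blinfun.bilinear_simps)
  have "g (z + s *\<^sub>R h + s *\<^sub>R k) - g (z + s *\<^sub>R h) - g (z + s *\<^sub>R k) + g z = \<phi> s - \<phi> 0"
    by (simp add: \<phi>_def)
  also have "\<dots> = s * (\<psi> s - \<psi> 0)" by (simp add: eq1 \<psi>_def)
  also have "\<dots> = s\<^sup>2 * D2g (z + \<sigma> *\<^sub>R h + \<tau> *\<^sub>R k) k h"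
    by (simp add: eq2 power2_eq_square)
  finally show ?thesis using near[of \<sigma> \<tau>] \<sigma> \<tau> by auto
qed

text \<open>The second difference is symmetric in \<open>h\<close> and \<open>k\<close>. Expanding
  it in both orders gives points \<open>p\<close> and \<open>q\<close> near \<open>z\<close> with
  \<open>D2g p k h = D2g q h k\<close>, and continuity of \<open>D2g\<close> at \<open>z\<close>
  carries the equality over to \<open>z\<close>.\<close>

lemma symmetric_second_derivative:
  fixes g :: "'z::real_normed_vector \<Rightarrow> real"
  assumes "open W" "z \<in> W"
    and g: "\<And>z. z \<in> W \<Longrightarrow> (g has_derivative blinfun_apply (Dg z)) (at z)"
    and Dg: "\<And>z. z \<in> W \<Longrightarrow> (Dg has_derivative blinfun_apply (D2g z)) (at z)"
    and cont: "continuous_on W D2g"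
  shows "D2g z h k = D2g z k h"
proof -
  have "\<bar>D2g z h k - D2g z k h\<bar> \<le> e" if "e > 0" for e
  proof -
    have c: "isCont (\<lambda>p. D2g p h k) z" "isCont (\<lambda>p. D2g p k h) z"
      using assms(1,2) cont by (auto simp: continuous_on_eq_continuous_at intro!: continuous_intros)
    obtain d1 where d1: "d1 > 0" "\<And>p. dist p z < d1 \<Longrightarrow> dist (D2g p h k) (D2g z h k) < e/2"
      using c(1) \<open>e > 0\<close> unfolding continuous_at_eps_delta by (meson half_gt_zero)
    obtain d2 where d2: "d2 > 0" "\<And>p. dist p z < d2 \<Longrightarrow> dist (D2g p k h) (D2g z k h) < e/2"
      using c(2) \<open>e > 0\<close> unfolding continuous_at_eps_delta by (meson half_gt_zero)
    obtain d3 where d3: "d3 > 0" "ball z d3 \<subseteq> W"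
      using assms(1,2) openE by blast
    define r where "r = min d1 (min d2 d3)"
    have r: "r > 0" "ball z r \<subseteq> W" using d1(1) d2(1) d3 by (auto simp: r_def)
    \<comment> \<open>This scale keeps the parallelogram spanned by \<open>s *\<^sub>R h\<close> and
      \<open>s *\<^sub>R k\<close> at \<open>z\<close> inside the ball of radius \<open>r\<close>;
      the added 1 keeps the denominator positive when \<open>h = k = 0\<close>.\<close>
    define s where "s = r / (norm h + norm k + 1)"
    have pos: "norm h + norm k + 1 > 0" by (smt (verit) norm_ge_zero)
    then have s: "s > 0" "s * (norm h + norm k) < r" "s * (norm k + norm h) < r"
      using r(1) by (auto simp: s_def field_simps)
    obtain p where p: "p \<in> ball z r"
      "g (z + s *\<^sub>R h + s *\<^sub>R k) - g (z + s *\<^sub>R h) - g (z + s *\<^sub>R k) + g z = s\<^sup>2 * D2g p k h"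
      using second_difference_mvt[where g=g and Dg=Dg and D2g=D2g and W=W, OF r(2) s(1,2) g Dg] by blast
    obtain q where q: "q \<in> ball z r"
      "g (z + s *\<^sub>R k + s *\<^sub>R h) - g (z + s *\<^sub>R k) - g (z + s *\<^sub>R h) + g z = s\<^sup>2 * D2g q h k"
      using second_difference_mvt[where g=g and Dg=Dg and D2g=D2g and W=W, OF r(2) s(1,3) g Dg] by blast
    have "s\<^sup>2 * D2g p k h = s\<^sup>2 * D2g q h k"
      using p(2) q(2) by (simp add: algebra_simps)
    then have eq: "D2g p k h = D2g q h k" using s(1) by simp
    have "dist (D2g q h k) (D2g z h k) < e/2" "dist (D2g p k h) (D2g z k h) < e/2"
      using p(1) q(1) d1(2) d2(2) by (auto simp: r_def dist_commute)
    then show ?thesis unfolding eq dist_real_def by linarith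
  qed
  from field_le_epsilon[of "\<bar>D2g z h k - D2g z k h\<bar>" 0] this
  show ?thesis by auto
qed

text \<open>The derivatives as bounded linear maps are assembled from the partial derivatives along
  \<open>Basis\<close>, whose derivatives and continuity are what \<open>Ck_on\<close>
  provides.\<close>

lemma C2_derivatives:
  fixes g :: "'z::euclidean_space \<Rightarrow> real"
  assumes "open W" and g: "Ck_on (Suc (Suc k)) W g"
  obtains Dg D2g where
    "\<And>z. z \<in> W \<Longrightarrow> (g has_derivative blinfun_apply (Dg z)) (at z)"
    "\<And>z. z \<in> W \<Longrightarrow> (Dg has_derivative blinfun_apply (D2g z)) (at z)"
    "continuous_on W D2g"
    "\<And>z h k. z \<in> W \<Longrightarrow> D2g z h k = D2g z k h"
proof -
  define d where "d b z = frechet_derivative g (at z) b" for b z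
  define d2 where "d2 b z = frechet_derivative (d b) (at z)" for b z
  define Dg where "Dg z = (\<Sum>b\<in>Basis. d b z *\<^sub>R blinfun_inner_left b)" for z
  define D2g where "D2g z = Blinfun (\<lambda>h. \<Sum>b\<in>Basis. d2 b z h *\<^sub>R blinfun_inner_left b)" for z
  have g1: "(g has_derivative (\<lambda>b. d b z)) (at z)" if "z \<in> W" for z
    using g that by (auto simp: d_def frechet_derivative_works)
  have d1: "(d b has_derivative d2 b z) (at z)" if "z \<in> W" for b z
    using g that by (auto simp: d_def[abs_def] d2_def frechet_derivative_works)
  have d2c: "continuous_on W (\<lambda>z. d2 b z h)" for b h
    using g by (auto simp: d_def[abs_def] d2_def intro!: Ck_on_imp_continuous_on)
  have Dg: "blinfun_apply (Dg z) = (\<lambda>h. d h z)" if "z \<in> W" for z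
  proof
    fix h
    have lin: "linear (\<lambda>h. d h z)"
      using g1[OF that] by (rule has_derivative_linear)
    show "Dg z h = d h z"
      using linear_sum[OF lin, of "\<lambda>b. (h \<bullet> b) *\<^sub>R b" Basis] linear_scale[OF lin]
      by (simp add: Dg_def blinfun.sum_left blinfun.scaleR_left euclidean_representation mult.commute)
  qed
  have bl: "bounded_linear (\<lambda>h. \<Sum>b\<in>Basis. d2 b z h *\<^sub>R blinfun_inner_left b :: 'z \<Rightarrow>\<^sub>L real)"
    if "z \<in> W" for z
    using d1[OF that]
    by (intro bounded_linear_sum bounded_linear_scaleR_left[THEN bounded_linear_compose])
       (auto intro: has_derivative_bounded_linear)
  have D2g: "blinfun_apply (D2g z) = (\<lambda>h. \<Sum>b\<in>Basis. d2 b z h *\<^sub>R blinfun_inner_left b)" if "z \<in> W" for z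
    using bl[OF that] by (simp add: D2g_def bounded_linear_Blinfun_apply)
  have 1: "(g has_derivative blinfun_apply (Dg z)) (at z)" if "z \<in> W" for z
    using g1 that by (simp add: Dg)
  have 2: "(Dg has_derivative blinfun_apply (D2g z)) (at z)" if "z \<in> W" for z
    unfolding Dg_def[abs_def] D2g[OF that]
    by (intro has_derivative_sum bounded_linear.has_derivative[OF bounded_linear_scaleR_left] d1 that)
  have 3: "continuous_on W D2g"
  proof (rule continuous_on_blinfun_componentwise)
    fix i :: 'z
    show "continuous_on W (\<lambda>z. D2g z i)"
      by (rule continuous_on_eq[of _ "\<lambda>z. \<Sum>b\<in>Basis. d2 b z i *\<^sub>R blinfun_inner_left b"])
         (auto intro!: continuous_intros d2c simp: D2g)
  qed
  show ?thesis
    using that[OF 1 2 3] symmetric_second_derivative[OF \<open>open W\<close> _ 1 2 3] by blast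
qed

text \<open>For a right inverse \<open>B\<close> of \<open>A = DF(u0)\<close>, the map \<open>G u = u + B (F u - A u)\<close> has derivative
  the identity at \<open>u0\<close> and satisfies \<open>A \<circ> G = F\<close>: it straightens the fibres of \<open>F\<close>.\<close>

lemma submersion_straightening:
  fixes F :: "'e::euclidean_space \<Rightarrow> 'f::euclidean_space"
  assumes "open S" "u0 \<in> S"
    and F: "\<And>u. u \<in> S \<Longrightarrow> (F has_derivative blinfun_apply (F' u)) (at u)"
    and cont: "continuous_on S F'"
    and surj: "surj (blinfun_apply (F' u0))"
  obtains G H H' N V where "open N" "N \<subseteq> S" "u0 \<in> N" "open V" "homeomorphism N V G H"
    "\<And>w. w \<in> V \<Longrightarrow> (H has_derivative H' w) (at w)"
    "\<And>k. continuous_on V (\<lambda>w. H' w k)"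
    "H' (G u0) = id"
    "\<And>u. u \<in> N \<Longrightarrow> F' u0 (G u) = F u"
proof -
  let ?A = "F' u0"
  obtain b where b: "linear b" "blinfun_apply ?A \<circ> b = id"
    using linear_surjective_right_inverse[OF _ surj] blinfun.bounded_linear_right bounded_linear.linear
    by blast
  define B where "B = Blinfun b"
  have B: "?A (B w) = w" for w
    using b by (simp add: B_def bounded_linear_Blinfun_apply linear_conv_bounded_linear fun_eq_iff)
  define G where "G u = u + B (F u - ?A u)" for u
  define G' where "G' u = id_blinfun + (B o\<^sub>L (F' u - ?A))" for u
  have G: "(G has_derivative blinfun_apply (G' u)) (at u)" if "u \<in> S" for u
    unfolding G_def[abs_def] G'_def using F[OF that]
    by (auto intro!: derivative_eq_intros simp: blinfun.bilinear_simps)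
  have G'c: "continuous_on S G'"
    unfolding G'_def[abs_def] using cont by (intro continuous_intros)
  have G'0: "G' u0 = id_blinfun" by (simp add: G'_def)
  have AG: "?A (G u) = F u" for u
    by (simp add: G_def blinfun.bilinear_simps B)
  \<comment> \<open>Staying within 1/2 of the identity makes \<open>G' u\<close> uniformly bounded
    below, which is the source of the continuity of \<open>H'\<close>.\<close>
  define S' where "S' = {u \<in> S. dist (G' u) id_blinfun < 1/2}"
  have "open S'"
  proof -
    have "S' = (\<lambda>u. dist (G' u) id_blinfun) -` {..<1/2} \<inter> S" by (auto simp: S'_def)
    moreover have "continuous_on S (\<lambda>u. dist (G' u) id_blinfun)"
      using G'c by (intro continuous_intros)
    ultimately show ?thesis
      using continuous_on_open_vimage[OF \<open>open S\<close>] by (metis open_lessThan)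
  qed
  have "u0 \<in> S'" using \<open>u0 \<in> S\<close> G'0 by (simp add: S'_def)
  have inv0: "id_blinfun o\<^sub>L G' u0 = id_blinfun" by (auto simp: G'0 intro!: blinfun_eqI)
  have "S' \<subseteq> S" by (auto simp: S'_def)
  have G1: "(G has_derivative blinfun_apply (G' u)) (at u)" if "u \<in> S'" for u
    using G that \<open>S' \<subseteq> S\<close> by blast
  obtain N V H H' where N: "open N" "N \<subseteq> S'" "u0 \<in> N" "open V" "G u0 \<in> V" "homeomorphism N V G H"
    and H: "\<And>w. w \<in> V \<Longrightarrow> (H has_derivative (H' w)) (at w)"
    and H': "\<And>w. w \<in> V \<Longrightarrow> H' w = inv (blinfun_apply (G' (H w)))"
    and bij: "\<And>w. w \<in> V \<Longrightarrow> bij (blinfun_apply (G' (H w)))"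
    using inverse_function_theorem[OF \<open>open S'\<close> G1 continuous_on_subset[OF G'c \<open>S' \<subseteq> S\<close>] \<open>u0 \<in> S'\<close> inv0]
    by metis
  have HN: "H w \<in> N" if "w \<in> V" for w using N(6) that by (auto simp: homeomorphism_def)
  have GH': "G' (H w) (H' w k) = k" if "w \<in> V" for w k
    using bij[OF that] H'[OF that] by (simp add: bij_is_surj surj_f_inv_f)
  have lower: "norm x \<le> 2 * norm (G' u x)" if "u \<in> S'" for u x
  proof -
    have "norm (x - G' u x) = norm ((G' u - id_blinfun) x)"
      by (simp add: blinfun.bilinear_simps norm_minus_commute)
    also have "\<dots> \<le> norm (G' u - id_blinfun) * norm x" by (rule norm_blinfun)
    also have "\<dots> \<le> 1/2 * norm x"
      using that by (intro mult_right_mono) (auto simp: S'_def dist_norm)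
    finally show ?thesis using norm_triangle_sub[of x "G' u x"] by linarith
  qed
  have contG'H: "continuous_on V (\<lambda>w. G' (H w))"
    using N(2,6) \<open>S' \<subseteq> S\<close> HN
    by (intro continuous_on_compose2[OF G'c]) (auto simp: homeomorphism_def)
  have H'c: "continuous_on V (\<lambda>w. H' w k)" for k
    unfolding continuous_on_def
  proof
    fix w assume w: "w \<in> V"
    have "((\<lambda>w'. (4 * norm k) * norm (G' (H w') - G' (H w))) \<longlongrightarrow> (4 * norm k) * norm (G' (H w) - G' (H w))) (at w within V)"
      using contG'H w by (intro tendsto_intros) (auto simp: continuous_on_def)
    then have t0: "((\<lambda>w'. (4 * norm k) * norm (G' (H w') - G' (H w))) \<longlongrightarrow> 0) (at w within V)"
      by simp
    \<comment> \<open>\<open>G' (H w)\<close> sends the difference \<open>H' w' k - H' w k\<close>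
      to \<open>(G' (H w) - G' (H w')) (H' w' k)\<close>. The bound \<open>lower\<close> is used
      once to remove \<open>G' (H w)\<close> and once to bound \<open>H' w' k\<close> by twice the
      norm of \<open>k\<close>, hence the factor 4.\<close>
    have le: "norm (H' w' k - H' w k) \<le> (4 * norm k) * norm (G' (H w') - G' (H w))" if "w' \<in> V" for w'
    proof -
      have in': "H w \<in> S'" "H w' \<in> S'" using HN N(2) that w by auto
      have "norm (H' w' k - H' w k) \<le> 2 * norm (G' (H w) (H' w' k - H' w k))"
        by (rule lower[OF in'(1)])
      also have "G' (H w) (H' w' k - H' w k) = (G' (H w) - G' (H w')) (H' w' k)"
        using GH'[OF w] GH'[OF that] by (simp add: blinfun.bilinear_simps)
      also have "2 * norm \<dots> \<le> 2 * (norm (G' (H w) - G' (H w')) * norm (H' w' k))"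
        using norm_blinfun by auto
      also have "\<dots> \<le> 2 * (norm (G' (H w) - G' (H w')) * (2 * norm k))"
        using lower[OF in'(2), of "H' w' k"] GH'[OF that]
        by (intro mult_left_mono) auto
      finally show ?thesis by (simp add: norm_minus_commute algebra_simps)
    qed
    have "((\<lambda>w'. H' w' k - H' w k) \<longlongrightarrow> 0) (at w within V)"
      by (rule Lim_null_comparison[OF _ t0]) (auto simp: eventually_at_filter le intro!: always_eventually)
    then show "((\<lambda>w'. H' w' k) \<longlongrightarrow> H' w k) (at w within V)" by (simp add: LIM_zero_iff)
  qed
  have HG0: "H (G u0) = u0" using N(3,6) by (auto simp: homeomorphism_def)
  have "H' (G u0) = id"
    using GH'[OF N(5)] by (auto simp: HG0 G'0)
  then show ?thesis
    using that[OF N(1) _ N(3,4,6) H H'c] N(2) \<open>S' \<subseteq> S\<close> AG by blast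
qed

subsection \<open>Covectors on a Euclidean space\<close>

text \<open>The Riesz identification of covectors with vectors. It turns annihilators into
  orthogonal complements and gives \<open>Dy\<close> values in a Euclidean space, so that
  \<open>submersion_straightening\<close> applies to it.\<close>

definition riesz :: "('a::euclidean_space \<Rightarrow>\<^sub>L real) \<Rightarrow>\<^sub>L 'a" where
  "riesz = Blinfun (\<lambda>l. \<Sum>b\<in>Basis. blinfun_apply l b *\<^sub>R b)"

lemma riesz_apply: "riesz l = (\<Sum>b\<in>Basis. blinfun_apply l b *\<^sub>R b)"
  unfolding riesz_def
  by (subst bounded_linear_Blinfun_apply)
     (auto intro!: bounded_linear_sum bounded_linear_scaleR_left[THEN bounded_linear_compose]
       blinfun.bounded_linear_left)

lemma inner_riesz: "riesz l \<bullet> v = blinfun_apply l v"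
proof -
  have "blinfun_apply l v = blinfun_apply l (\<Sum>b\<in>Basis. (v \<bullet> b) *\<^sub>R b)"
    by (simp add: euclidean_representation)
  also have "\<dots> = riesz l \<bullet> v"
    by (simp add: riesz_apply inner_sum_left blinfun.bilinear_simps inner_commute[of v] mult.commute
         blinfun.sum_right)
  finally show ?thesis by simp
qed

lemma inj_riesz: "inj (blinfun_apply riesz)"
  by (rule injI) (metis inner_riesz blinfun_eqI)

lemma surj_riesz: "surj (blinfun_apply riesz)"
proof (rule surjI)
  show "riesz (blinfun_inner_right v) = v" for v :: 'a
    by (rule vector_eq_rdot[THEN iffD1]) (simp add: inner_riesz)
qed

lemma dim_riesz_image: "dim (riesz ` V) = dim V"
proof -
  have lin: "linear (blinfun_apply riesz)"
    using blinfun.bounded_linear_right bounded_linear.linear by blast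
  obtain B where B: "B \<subseteq> V" "independent B" "V \<subseteq> span B" "card B = dim V"
    by (rule basis_exists)
  have ind: "independent (riesz ` B)"
    using linear_independent_injective_image[OF lin B(2)] inj_riesz by (auto intro: inj_on_subset)
  have "riesz ` V \<subseteq> span (riesz ` B)"
    using B(3) by (auto simp: linear_span_image[OF lin])
  then have "dim (riesz ` V) = card (riesz ` B)"
    using B(1) ind by (intro dim_unique) auto
  also have "\<dots> = card B"
    using inj_riesz by (intro card_image) (auto intro: inj_on_subset)
  finally show ?thesis using B(4) by simp
qed

subsection \<open>Charts\<close>

lemma chart_facts:
  assumes "smooth_manifold M A" "(U, \<phi>) \<in> A"
  shows "U \<subseteq> M" "openin (top_of_set M) U" "open (\<phi> ` U)" "continuous_on U \<phi>"
    "continuous_on (\<phi> ` U) (inv_into U \<phi>)"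
    "\<And>x. x \<in> U \<Longrightarrow> inv_into U \<phi> (\<phi> x) = x"
  using assms unfolding smooth_manifold_def homeomorphism_def by blast+

lemma chart_image_Int_open:
  assumes "smooth_manifold M A" "(U, \<phi>) \<in> A" "openin (top_of_set M) T"
  shows "open (\<phi> ` (U \<inter> T))"
proof -
  note c = chart_facts[OF assms(1,2)]
  obtain T' where T': "open T'" "T = M \<inter> T'" using assms(3) by (auto simp: openin_open)
  have "\<phi> ` (U \<inter> T) = inv_into U \<phi> -` T' \<inter> \<phi> ` U"
  proof (intro equalityI subsetI)
    fix u assume "u \<in> \<phi> ` (U \<inter> T)"
    then show "u \<in> inv_into U \<phi> -` T' \<inter> \<phi> ` U" using c(6) T'(2) by auto
  next
    fix u assume "u \<in> inv_into U \<phi> -` T' \<inter> \<phi> ` U"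
    then obtain x where "x \<in> U" "u = \<phi> x" "x \<in> T'" using c(6) by auto
    then show "u \<in> \<phi> ` (U \<inter> T)" using c(1) T'(2) by auto
  qed
  moreover have "open (inv_into U \<phi> -` T' \<inter> \<phi> ` U)"
    using c(3,5) T'(1) continuous_on_open_vimage by blast
  ultimately show ?thesis by simp
qed

lemma chart_at_mem:
  assumes "smooth_manifold M A" "x \<in> M" "chart_at A x = (U, \<phi>)"
  shows "(U, \<phi>) \<in> A" "x \<in> U"
proof -
  have "\<exists>K. K \<in> A \<and> x \<in> fst K"
    using assms(1,2) unfolding smooth_manifold_def by force
  from someI_ex[OF this] assms(3) show "(U, \<phi>) \<in> A" "x \<in> U" by (auto simp: chart_at_def)
qed

lemma transition_derivative:
  assumes "smooth_manifold M A" "(U, \<phi>) \<in> A" "(V, \<psi>) \<in> A" "x \<in> U" "x \<in> V"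
  shows "\<exists>T. ((\<psi> \<circ> inv_into U \<phi>) has_derivative T) (at (\<phi> x))"
proof -
  have "smooth_on (\<phi> ` (U \<inter> V)) (\<psi> \<circ> inv_into U \<phi>)"
    using assms(1-3) unfolding smooth_manifold_def by blast
  then have "Ck_on (Suc 0) (\<phi> ` (U \<inter> V)) (\<psi> \<circ> inv_into U \<phi>)"
    unfolding smooth_on_def by blast
  with assms(4,5) show ?thesis
    by (auto simp: differentiable_def)
qed

text \<open>This is the chain rule for the transition map. The composite agrees with
  \<open>h\<close> read in the chart \<open>\<phi>\<close> only on the image of the chart overlap,
  which is open and contains the point in question.\<close>

lemma derivative_change_chart:
  assumes "smooth_manifold M A" "(U, \<phi>) \<in> A" "(V, \<psi>) \<in> A" "x \<in> U" "x \<in> V"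
    and T: "((\<psi> \<circ> inv_into U \<phi>) has_derivative T) (at (\<phi> x))"
    and D: "((\<lambda>v. h (inv_into V \<psi> v)) has_derivative D) (at (\<psi> x))"
  shows "((\<lambda>u. h (inv_into U \<phi> u)) has_derivative (\<lambda>k. D (T k))) (at (\<phi> x))"
proof (rule has_derivative_transform_within_open)
  note U = chart_facts[OF assms(1,2)] and V = chart_facts[OF assms(1,3)]
  have "(\<psi> \<circ> inv_into U \<phi>) (\<phi> x) = \<psi> x" using U(6) assms(4) by simp
  with D have "((\<lambda>v. h (inv_into V \<psi> v)) has_derivative D) (at ((\<psi> \<circ> inv_into U \<phi>) (\<phi> x)))" by simp
  from has_derivative_compose[where g="\<lambda>v. h (inv_into V \<psi> v)", OF T this]
  show "((\<lambda>u. h (inv_into V \<psi> ((\<psi> \<circ> inv_into U \<phi>) u))) has_derivative (\<lambda>k. D (T k))) (at (\<phi> x))" .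
  show "open (\<phi> ` (U \<inter> V))" by (rule chart_image_Int_open[OF assms(1,2) V(2)])
  show "\<phi> x \<in> \<phi> ` (U \<inter> V)" using assms(4,5) by blast
  show "h (inv_into V \<psi> ((\<psi> \<circ> inv_into U \<phi>) u)) = h (inv_into U \<phi> u)" if "u \<in> \<phi> ` (U \<inter> V)" for u
    using that U(6) V(6) by auto
qed

text \<open>A vanishing derivative makes \<open>h\<close> constant on the preimage of a convex ball
  in a chart, hence locally constant, and connectedness of \<open>M\<close> does the rest.\<close>

lemma constant_of_derivative_zero:
  fixes h :: "'a::{t2_space, second_countable_topology} \<Rightarrow> 'g::real_normed_vector"
    and A :: "('a, 'e::euclidean_space) chart set"
  assumes M: "smooth_manifold M A" and "connected M"
    and D: "\<And>x U \<phi>. x \<in> M \<Longrightarrow> chart_at A x = (U, \<phi>) \<Longrightarrow>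
              ((\<lambda>u. h (inv_into U \<phi> u)) has_derivative (\<lambda>_. 0)) (at (\<phi> x))"
    and "x \<in> M" "y \<in> M"
  shows "h x = h y"
proof (rule connected_local_const[OF \<open>connected M\<close> \<open>x \<in> M\<close> \<open>y \<in> M\<close>], rule ballI)
  fix a assume a: "a \<in> M"
  obtain U \<phi> where c: "chart_at A a = (U, \<phi>)" by fastforce
  note mem = chart_at_mem[OF M a c]
  note U = chart_facts[OF M mem(1)]
  obtain r where r: "r > 0" "ball (\<phi> a) r \<subseteq> \<phi> ` U"
    using U(3) mem(2) openE by blast
  \<comment> \<open>The hypothesis concerns each point in its own preferred chart, whereas one fixed
    chart is needed on the whole ball; the transition maps transfer it.\<close>
  have D0: "((\<lambda>u. h (inv_into U \<phi> u)) has_derivative (\<lambda>_. 0)) (at u)" if u: "u \<in> \<phi> ` U" for u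
  proof -
    obtain b where b: "b \<in> U" "u = \<phi> b" using u by blast
    obtain V \<psi> where V: "chart_at A b = (V, \<psi>)" by fastforce
    have "b \<in> M" using b U(1) by blast
    note mV = chart_at_mem[OF M this V]
    obtain T where T: "((\<psi> \<circ> inv_into U \<phi>) has_derivative T) (at (\<phi> b))"
      using transition_derivative[OF M mem(1) mV(1) b(1) mV(2)] by blast
    show ?thesis
      using derivative_change_chart[OF M mem(1) mV(1) b(1) mV(2) T D[OF \<open>b \<in> M\<close> V]] b by simp
  qed
  have eq: "h (inv_into U \<phi> u) = h (inv_into U \<phi> v)" if "u \<in> ball (\<phi> a) r" "v \<in> ball (\<phi> a) r" for u v
    by (rule has_derivative_zero_unique[OF convex_ball _ that])
       (use D0 r(2) in \<open>blast intro: has_derivative_at_withinI\<close>)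
  \<comment> \<open>Chart domains are open only relative to \<open>M\<close>. The neighbourhood of
    \<open>a\<close> is therefore cut out by two open sets of the ambient space: \<open>T\<close>
    for the ball in coordinates and \<open>T'\<close> for the chart domain.\<close>
  obtain T where T: "open T" "\<phi> -` ball (\<phi> a) r \<inter> U = T \<inter> U"
    using U(4) by (metis continuous_on_open_invariant open_ball Int_commute)
  obtain T' where T': "open T'" "U = M \<inter> T'" using U(2) by (auto simp: openin_open)
  show "\<forall>\<^sub>F b in at a within M. h a = h b"
    unfolding eventually_at_topological
  proof (intro exI[of _ "T \<inter> T'"] conjI ballI impI)
    show "open (T \<inter> T')" using T T' by blast
    show "a \<in> T \<inter> T'" using T T' r(1) mem(2) by auto
    fix b assume "b \<in> T \<inter> T'" "b \<in> M"
    then have b: "b \<in> U" "\<phi> b \<in> ball (\<phi> a) r" using T(2) T'(2) by auto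
    have "\<phi> a \<in> ball (\<phi> a) r" using r(1) by simp
    from eq[OF this b(2)] show "h a = h b"
      using U(6) b(1) mem(2) by simp
  qed
qed

subsection \<open>Level sets of \<open>D\<^sub>yc\<close>\<close>

text \<open>The atlases \<open>AM\<close> and \<open>AN\<close> of the larger manifolds are kept
  because the regularity of \<open>c\<close> is stated in their charts. The order
  \<open>Suc (Suc k)\<close> lets the recursion of \<open>Ck_on\<close> unfold twice.\<close>

locale cost_on_manifolds =
  fixes X :: "'a::{t2_space, second_countable_topology} set"
    and Y :: "'b::{t2_space, second_countable_topology} set"
    and AX :: "('a, 'e::euclidean_space) chart set"
    and AY :: "('b, 'f::euclidean_space) chart set"
    and AM :: "('a, 'p::euclidean_space) chart set"
    and AN :: "('b, 'q::euclidean_space) chart set"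
    and c :: "'a \<Rightarrow> 'b \<Rightarrow> real"
    and k :: nat
  assumes X: "smooth_manifold X AX" and Y: "smooth_manifold Y AY"
    and M: "smooth_manifold UNIV AM" and XM: "smoothly_embedded AX AM"
    and N: "smooth_manifold UNIV AN" and YN: "smoothly_embedded AY AN"
    and c: "Ck_on_product (Suc (Suc k)) AM AN (closure X) (closure Y) c"
begin

section \<open>Mixed derivatives in coordinates\<close>

text \<open>In charts of \<open>X\<close> and \<open>Y\<close>, \<open>c\<close> becomes
  \<open>g (a u, b v)\<close> with a local extension \<open>g\<close> and the coordinate expressions
  \<open>a\<close>, \<open>b\<close> of the embeddings. In \<open>fx u v\<close> the factor
  \<open>a' u\<close> does not depend on \<open>v\<close>, so the mixed derivative differentiates
  only \<open>Dg\<close>, and likewise for \<open>fy\<close>. Symmetry of \<open>D2g\<close> then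
  gives symmetry of the mixed derivatives.\<close>

lemma local_mixed_derivatives:
  assumes x: "x \<in> X" and y: "y \<in> Y"
    and U: "(U, \<phi>) \<in> AX" "x \<in> U" and V: "(V, \<psi>) \<in> AY" "y \<in> V"
  obtains O1 O2 fx fy fxy fyx where
    "open O1" "\<phi> x \<in> O1" "O1 \<subseteq> \<phi> ` U" "open O2" "\<psi> y \<in> O2" "O2 \<subseteq> \<psi> ` V"
    "\<And>u v. u \<in> O1 \<Longrightarrow> v \<in> O2 \<Longrightarrow>
       ((\<lambda>u. c (inv_into U \<phi> u) (inv_into V \<psi> v)) has_derivative blinfun_apply (fx u v)) (at u)"
    "\<And>u v. u \<in> O1 \<Longrightarrow> v \<in> O2 \<Longrightarrow>
       ((\<lambda>v. c (inv_into U \<phi> u) (inv_into V \<psi> v)) has_derivative blinfun_apply (fy u v)) (at v)"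
    "\<And>u v. u \<in> O1 \<Longrightarrow> v \<in> O2 \<Longrightarrow> ((\<lambda>v. fx u v) has_derivative blinfun_apply (fxy u v)) (at v)"
    "\<And>u v. u \<in> O1 \<Longrightarrow> v \<in> O2 \<Longrightarrow> ((\<lambda>u. fy u v) has_derivative blinfun_apply (fyx u v)) (at u)"
    "\<And>u v h k. u \<in> O1 \<Longrightarrow> v \<in> O2 \<Longrightarrow>
       blinfun_apply (blinfun_apply (fxy u v) k) h = blinfun_apply (blinfun_apply (fyx u v) h) k"
    "\<And>v. v \<in> O2 \<Longrightarrow> continuous_on O1 (\<lambda>u. fyx u v)"
proof -
  note cU = chart_facts[OF X U(1)] and cV = chart_facts[OF Y V(1)]
  have "x \<in> closure X" "y \<in> closure Y" using x y closure_subset by auto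
  from c[unfolded Ck_on_product_def, rule_format, OF this]
  obtain P \<pi> Q \<rho> W g where P: "(P, \<pi>) \<in> AM" "x \<in> P" and Q: "(Q, \<rho>) \<in> AN" "y \<in> Q"
    and W: "open W" "(\<pi> x, \<rho> y) \<in> W" and g: "Ck_on (Suc (Suc k)) W g"
    and eq: "\<forall>x \<in> closure X \<inter> P. \<forall>y \<in> closure Y \<inter> Q. (\<pi> x, \<rho> y) \<in> W \<longrightarrow> g (\<pi> x, \<rho> y) = c x y"
    by (elim bexE case_prodE conjE exE) simp
  define a where "a = \<pi> \<circ> inv_into U \<phi>"
  define b where "b = \<rho> \<circ> inv_into V \<psi>"
  have "open P" "open Q"
    using chart_facts(2)[OF M P(1)] chart_facts(2)[OF N Q(1)] by auto
  let ?A = "\<phi> ` (U \<inter> P)" and ?B = "\<psi> ` (V \<inter> Q)"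
  have "openin (top_of_set X) (X \<inter> P)" "openin (top_of_set Y) (Y \<inter> Q)"
    using \<open>open P\<close> \<open>open Q\<close> by auto
  from chart_image_Int_open[OF X U(1) this(1)] chart_image_Int_open[OF Y V(1) this(2)]
  have open_AB: "open ?A" "open ?B"
    using cU(1) cV(1) by (auto simp: Int_assoc[symmetric] Int_absorb2)
  have sm: "smooth_on ?A a" "smooth_on ?B b"
    using XM YN U V P Q unfolding smoothly_embedded_def a_def b_def by blast+
  have "Ck_on (Suc 0) ?A a" "Ck_on (Suc 0) ?B b" using sm unfolding smooth_on_def by blast+
  then obtain a' b' where a: "\<And>u. u \<in> ?A \<Longrightarrow> (a has_derivative blinfun_apply (a' u)) (at u)"
      "continuous_on ?A a'"
    and b: "\<And>v. v \<in> ?B \<Longrightarrow> (b has_derivative blinfun_apply (b' v)) (at v)"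
    by (metis C1_derivative)
  obtain Dg D2g where Dg: "\<And>z. z \<in> W \<Longrightarrow> (g has_derivative blinfun_apply (Dg z)) (at z)"
    and D2g: "\<And>z. z \<in> W \<Longrightarrow> (Dg has_derivative blinfun_apply (D2g z)) (at z)"
    and D2g_cont: "continuous_on W D2g"
    and sym: "\<And>z h k. z \<in> W \<Longrightarrow> D2g z h k = D2g z k h"
    using C2_derivatives[OF W(1) g] by blast
  have ca: "continuous_on ?A a" and cb: "continuous_on ?B b"
    using smooth_on_imp_continuous_on sm by blast+
  define Z where "Z = (\<lambda>z. (a (fst z), b (snd z))) -` W \<inter> (?A \<times> ?B)"
  have "open Z"
    unfolding Z_def using open_AB W(1)
    by (intro continuous_open_vimage continuous_on_open_vimage[THEN iffD1, rule_format])
       (auto intro!: open_Times continuous_intros continuous_on_compose2[OF ca] continuous_on_compose2[OF cb])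
  moreover have "(\<phi> x, \<psi> y) \<in> Z"
    using U V P Q W(2) cU(6) cV(6) by (auto simp: Z_def a_def b_def)
  ultimately obtain O1 O2 where O: "open O1" "open O2" "(\<phi> x, \<psi> y) \<in> O1 \<times> O2" "O1 \<times> O2 \<subseteq> Z"
    by (rule open_prod_elim)
  have O1: "\<phi> x \<in> O1" "O1 \<subseteq> ?A" and O2: "\<psi> y \<in> O2" "O2 \<subseteq> ?B"
    using O(3,4) by (auto simp: Z_def)
  have OW: "(a u, b v) \<in> W" if "u \<in> O1" "v \<in> O2" for u v
    using that O(4) by (auto simp: Z_def)
  have ceq: "c (inv_into U \<phi> u) (inv_into V \<psi> v) = g (a u, b v)" if uv: "u \<in> O1" "v \<in> O2" for u v
  proof -
    obtain x' y' where x': "x' \<in> U" "x' \<in> P" "u = \<phi> x'" and y': "y' \<in> V" "y' \<in> Q" "v = \<psi> y'"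
      using uv O1 O2 by blast
    have "x' \<in> closure X" "y' \<in> closure Y" using x' y' cU(1) cV(1) closure_subset by blast+
    with x' y' OW[OF uv] show ?thesis
      using eq cU(6) cV(6) by (simp add: a_def b_def)
  qed
  define iL :: "'p  \<Rightarrow>\<^sub>L ('p \<times> 'q)" where "iL = Blinfun (\<lambda>p. (p, 0))"
  define iR :: "'q  \<Rightarrow>\<^sub>L ('p \<times> 'q)" where "iR = Blinfun (\<lambda>q. (0, q))"
  have iL: "blinfun_apply iL = (\<lambda>p. (p, 0))" and iR: "blinfun_apply iR = (\<lambda>q. (0, q))"
    unfolding iL_def iR_def
    by (intro bounded_linear_Blinfun_apply bounded_linear_Pair bounded_linear_ident bounded_linear_zero)+
  \<comment> \<open>Precomposition with a fixed \<open>B\<close> is packaged as a bounded linear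
    operator on covectors, so that it commutes with taking derivatives of \<open>Dg\<close>.\<close>
  define post1 :: "('e \<Rightarrow>\<^sub>L ('p \<times> 'q)) \<Rightarrow> (('p \<times> 'q) \<Rightarrow>\<^sub>L real) \<Rightarrow>\<^sub>L ('e \<Rightarrow>\<^sub>L real)"
    where "post1 B = Blinfun (\<lambda>l. l o\<^sub>L B)" for B
  define post2 :: "('f \<Rightarrow>\<^sub>L ('p \<times> 'q)) \<Rightarrow> (('p \<times> 'q) \<Rightarrow>\<^sub>L real) \<Rightarrow>\<^sub>L ('f \<Rightarrow>\<^sub>L real)"
    where "post2 B = Blinfun (\<lambda>l. l o\<^sub>L B)" for B
  have post: "blinfun_apply (post1 B1) = (\<lambda>l. l o\<^sub>L B1)" "blinfun_apply (post2 B2) = (\<lambda>l. l o\<^sub>L B2)" for B1 B2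
    unfolding post1_def post2_def
    by (intro bounded_linear_Blinfun_apply
        bounded_bilinear.bounded_linear_left[OF bounded_bilinear_blinfun_compose])+
  define fx where "fx u v = Dg (a u, b v) o\<^sub>L (iL o\<^sub>L a' u)" for u v
  define fy where "fy u v = Dg (a u, b v) o\<^sub>L (iR o\<^sub>L b' v)" for u v
  define fxy where "fxy u v = post1 (iL o\<^sub>L a' u) o\<^sub>L D2g (a u, b v) o\<^sub>L (iR o\<^sub>L b' v)" for u v
  define fyx where "fyx u v = post2 (iR o\<^sub>L b' v) o\<^sub>L D2g (a u, b v) o\<^sub>L (iL o\<^sub>L a' u)" for u v
  have du: "((\<lambda>u. (a u, b v)) has_derivative blinfun_apply (iL o\<^sub>L a' u)) (at u)" if "u \<in> O1" for u v
  proof -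
    have "((\<lambda>u. (a u, b v)) has_derivative (\<lambda>h. (a' u h, 0))) (at u)"
      using that O1(2) by (intro has_derivative_Pair a has_derivative_const) auto
    moreover have "blinfun_apply (iL o\<^sub>L a' u) = (\<lambda>h. (a' u h, 0))" by (auto simp: iL)
    ultimately show ?thesis by simp
  qed
  have dv: "((\<lambda>v. (a u, b v)) has_derivative blinfun_apply (iR o\<^sub>L b' v)) (at v)" if "v \<in> O2" for u v
  proof -
    have "((\<lambda>v. (a u, b v)) has_derivative (\<lambda>h. (0, b' v h))) (at v)"
      using that O2(2) by (intro has_derivative_Pair b has_derivative_const) auto
    moreover have "blinfun_apply (iR o\<^sub>L b' v) = (\<lambda>h. (0, b' v h))" by (auto simp: iR)
    ultimately show ?thesis by simp
  qed
  have 1: "((\<lambda>u. c (inv_into U \<phi> u) (inv_into V \<psi> v)) has_derivative blinfun_apply (fx u v)) (at u)"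
    if "u \<in> O1" "v \<in> O2" for u v
  proof (rule has_derivative_transform_within_open[OF _ O(1) that(1)])
    show "((\<lambda>u. g (a u, b v)) has_derivative blinfun_apply (fx u v)) (at u)"
      using has_derivative_compose[where g=g and f="\<lambda>u. (a u, b v)", OF du[OF that(1)] Dg[OF OW[OF that]]]
      by (simp add: fx_def blinfun_compose.rep_eq o_def)
  qed (simp add: ceq that)
  have 2: "((\<lambda>v. c (inv_into U \<phi> u) (inv_into V \<psi> v)) has_derivative blinfun_apply (fy u v)) (at v)"
    if "u \<in> O1" "v \<in> O2" for u v
  proof (rule has_derivative_transform_within_open[OF _ O(2) that(2)])
    show "((\<lambda>v. g (a u, b v)) has_derivative blinfun_apply (fy u v)) (at v)"
      using has_derivative_compose[where g=g and f="\<lambda>v. (a u, b v)", OF dv[OF that(2)] Dg[OF OW[OF that]]]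
      by (simp add: fy_def blinfun_compose.rep_eq o_def)
  qed (simp add: ceq that)
  have 3: "((\<lambda>v. fx u v) has_derivative blinfun_apply (fxy u v)) (at v)" if "u \<in> O1" "v \<in> O2" for u v
  proof -
    have "((\<lambda>v. Dg (a u, b v)) has_derivative (\<lambda>k. D2g (a u, b v) ((iR o\<^sub>L b' v) k))) (at v)"
      by (rule has_derivative_compose[where g=Dg and f="\<lambda>v. (a u, b v)", OF dv[OF that(2)] D2g[OF OW[OF that]]])
    from bounded_linear.has_derivative[OF blinfun.bounded_linear_right[of "post1 (iL o\<^sub>L a' u)"] this]
    show ?thesis by (simp add: fx_def fxy_def post blinfun_compose.rep_eq o_def)
  qed
  have 4: "((\<lambda>u. fy u v) has_derivative blinfun_apply (fyx u v)) (at u)" if "u \<in> O1" "v \<in> O2" for u v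
  proof -
    have "((\<lambda>u. Dg (a u, b v)) has_derivative (\<lambda>k. D2g (a u, b v) ((iL o\<^sub>L a' u) k))) (at u)"
      by (rule has_derivative_compose[where g=Dg and f="\<lambda>u. (a u, b v)", OF du[OF that(1)] D2g[OF OW[OF that]]])
    from bounded_linear.has_derivative[OF blinfun.bounded_linear_right[of "post2 (iR o\<^sub>L b' v)"] this]
    show ?thesis by (simp add: fy_def fyx_def post blinfun_compose.rep_eq o_def)
  qed
  have 5: "fxy u v k h = fyx u v h k" if "u \<in> O1" "v \<in> O2" for u v h k
    using sym[OF OW[OF that]] by (simp add: fxy_def fyx_def post)
  have 6: "continuous_on O1 (\<lambda>u. fyx u v)" if "v \<in> O2" for v
  proof -
    have "continuous_on O1 (\<lambda>u. D2g (a u, b v))"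
      using OW that continuous_on_subset[OF ca O1(2)]
      by (intro continuous_on_compose2[OF D2g_cont]) (auto intro!: continuous_intros)
    moreover have "continuous_on O1 a'" using a(2) O1(2) by (rule continuous_on_subset)
    ultimately show ?thesis
      unfolding fyx_def by (intro continuous_intros)
  qed
  show ?thesis
    by (rule that[of O1 O2 fx fy fxy fyx, OF O(1) O1(1) _ O(2) O2(1) _ 1 2 3 4 5 6]) (use O1(2) O2(2) in auto)
qed

text \<open>The chart on \<open>X\<close> is arbitrary, since the derivative is later followed
  through points whose preferred charts differ. Only the statements involving \<open>Dx\<close> or
  \<open>D2xy\<close> at \<open>x\<close> ask for the preferred chart, because those covectors are
  expressed in it.\<close>

lemma Dy_derivative:
  assumes x: "x \<in> X" and y: "y \<in> Y" and U: "(U, \<phi>) \<in> AX" "x \<in> U"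
  obtains S F' where "open S" "\<phi> x \<in> S" "S \<subseteq> \<phi> ` U"
    "\<And>u. u \<in> S \<Longrightarrow> ((\<lambda>u. Dy AY c (inv_into U \<phi> u) y) has_derivative blinfun_apply (F' u)) (at u)"
    "continuous_on S F'"
    "\<And>h k. chart_at AX x = (U, \<phi>) \<Longrightarrow>
       blinfun_apply (blinfun_apply (F' (\<phi> x)) h) k = blinfun_apply (blinfun_apply (D2xy AX AY c x y) k) h"
    "\<And>V \<psi>. chart_at AX x = (U, \<phi>) \<Longrightarrow> chart_at AY y = (V, \<psi>) \<Longrightarrow>
       ((\<lambda>v. Dx AX c x (inv_into V \<psi> v)) has_derivative blinfun_apply (D2xy AX AY c x y)) (at (\<psi> y))"
proof -
  obtain V \<psi> where cV: "chart_at AY y = (V, \<psi>)" by fastforce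
  note V = chart_at_mem[OF Y y cV]
  note fU = chart_facts[OF X U(1)] and fV = chart_facts[OF Y V(1)]
  obtain O1 O2 fx fy fxy fyx where O: "open O1" "\<phi> x \<in> O1" "O1 \<subseteq> \<phi> ` U" "open O2" "\<psi> y \<in> O2" "O2 \<subseteq> \<psi> ` V"
    and fx: "\<And>u v. u \<in> O1 \<Longrightarrow> v \<in> O2 \<Longrightarrow>
       ((\<lambda>u. c (inv_into U \<phi> u) (inv_into V \<psi> v)) has_derivative blinfun_apply (fx u v)) (at u)"
    and fy: "\<And>u v. u \<in> O1 \<Longrightarrow> v \<in> O2 \<Longrightarrow>
       ((\<lambda>v. c (inv_into U \<phi> u) (inv_into V \<psi> v)) has_derivative blinfun_apply (fy u v)) (at v)"
    and fxy: "\<And>u v. u \<in> O1 \<Longrightarrow> v \<in> O2 \<Longrightarrow> ((\<lambda>v. fx u v) has_derivative blinfun_apply (fxy u v)) (at v)"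
    and fyx: "\<And>u v. u \<in> O1 \<Longrightarrow> v \<in> O2 \<Longrightarrow> ((\<lambda>u. fy u v) has_derivative blinfun_apply (fyx u v)) (at u)"
    and sym: "\<And>u v h k. u \<in> O1 \<Longrightarrow> v \<in> O2 \<Longrightarrow>
       blinfun_apply (blinfun_apply (fxy u v) k) h = blinfun_apply (blinfun_apply (fyx u v) h) k"
    and cont: "\<And>v. v \<in> O2 \<Longrightarrow> continuous_on O1 (\<lambda>u. fyx u v)"
    by (rule local_mixed_derivatives[OF x y U V]) blast
  have Dy: "Dy AY c (inv_into U \<phi> u) y = fy u (\<psi> y)" if "u \<in> O1" for u
    by (simp add: Dy_def differential_def cV o_def blinfun_apply_inverse
        frechet_derivative_at[OF fy[OF that O(5)], symmetric])
  have 1: "((\<lambda>u. Dy AY c (inv_into U \<phi> u) y) has_derivative blinfun_apply (fyx u (\<psi> y))) (at u)"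
    if "u \<in> O1" for u
    by (rule has_derivative_transform_within_open[OF fyx[OF that O(5)] O(1) that]) (simp add: Dy)
  have Dx: "Dx AX c x (inv_into V \<psi> v) = fx (\<phi> x) v" if "v \<in> O2" "chart_at AX x = (U, \<phi>)" for v
    by (simp add: Dx_def differential_def that(2) o_def blinfun_apply_inverse
        frechet_derivative_at[OF fx[OF O(2) that(1)], symmetric])
  have 2: "((\<lambda>v. Dx AX c x (inv_into V \<psi> v)) has_derivative blinfun_apply (fxy (\<phi> x) (\<psi> y))) (at (\<psi> y))"
    if "chart_at AX x = (U, \<phi>)"
    by (rule has_derivative_transform_within_open[OF fxy[OF O(2,5)] O(4,5)]) (simp add: Dx that)
  have 3: "D2xy AX AY c x y = fxy (\<phi> x) (\<psi> y)" if "chart_at AX x = (U, \<phi>)"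
    by (simp add: D2xy_def differential_def cV o_def blinfun_apply_inverse
        frechet_derivative_at[OF 2[OF that], symmetric])
  show ?thesis
  proof (rule that[of O1 "\<lambda>u. fyx u (\<psi> y)"])
    show "fyx (\<phi> x) (\<psi> y) h k = D2xy AX AY c x y k h" if "chart_at AX x = (U, \<phi>)" for h k
      using sym[OF O(2,5)] 3[OF that] by simp
    show "((\<lambda>v. Dx AX c x (inv_into V' \<psi>' v)) has_derivative D2xy AX AY c x y) (at (\<psi>' y))"
      if "chart_at AX x = (U, \<phi>)" "chart_at AY y = (V', \<psi>')" for V' \<psi>'
      using 2[OF that(1)] 3[OF that(1)] that(2) cV by simp
  qed (use O 1 cont in auto)
qed

lemma Dx_derivative:
  assumes x: "x \<in> X" and y: "y \<in> Y" and V: "chart_at AY y = (V, \<psi>)"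
  shows "((\<lambda>v. Dx AX c x (inv_into V \<psi> v)) has_derivative blinfun_apply (D2xy AX AY c x y)) (at (\<psi> y))"
proof -
  obtain U \<phi> where cU: "chart_at AX x = (U, \<phi>)" by fastforce
  show ?thesis
    by (rule Dy_derivative[OF x y chart_at_mem[OF X x cU]]) (use cU V in blast)
qed

definition mixed_kernel :: "'a \<Rightarrow> 'b \<Rightarrow> 'e set" where
  "mixed_kernel x y = {h. \<forall>k. blinfun_apply (blinfun_apply (D2xy AX AY c x y) k) h = 0}"

text \<open>\<open>T\<close> is the derivative of the transition from \<open>\<phi>\<close> to the
  preferred chart at \<open>x\<close>. One \<open>T\<close> serves all \<open>y\<close>, so equality
  of the mixed kernels at two points of \<open>Y\<close> can be exploited in any chart.\<close>

lemma Dy_derivative_kernel: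
  assumes x: "x \<in> X" and U: "(U, \<phi>) \<in> AX" "x \<in> U"
  obtains T where "\<And>y D h. y \<in> Y \<Longrightarrow> ((\<lambda>u. Dy AY c (inv_into U \<phi> u) y) has_derivative D) (at (\<phi> x)) \<Longrightarrow>
     D h = 0 \<longleftrightarrow> T h \<in> mixed_kernel x y"
proof -
  obtain V \<psi> where cV: "chart_at AX x = (V, \<psi>)" by fastforce
  note V = chart_at_mem[OF X x cV]
  obtain T where T: "((\<psi> \<circ> inv_into U \<phi>) has_derivative T) (at (\<phi> x))"
    using transition_derivative[OF X U(1) V(1) U(2) V(2)] by blast
  show ?thesis
  proof
    fix y D h
    assume y: "y \<in> Y" and D: "((\<lambda>u. Dy AY c (inv_into U \<phi> u) y) has_derivative D) (at (\<phi> x))"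
    obtain S F' where S: "\<psi> x \<in> S"
      and F': "\<And>u. u \<in> S \<Longrightarrow> ((\<lambda>u. Dy AY c (inv_into V \<psi> u) y) has_derivative blinfun_apply (F' u)) (at u)"
      and ker: "\<And>h k. blinfun_apply (blinfun_apply (F' (\<psi> x)) h) k = blinfun_apply (blinfun_apply (D2xy AX AY c x y) k) h"
      by (rule Dy_derivative[OF x y V]) (use cV in blast)
    from derivative_change_chart[where h="\<lambda>x. Dy AY c x y", OF X U(1) V(1) U(2) V(2) T F'[OF S]]
    have "D = (\<lambda>h. F' (\<psi> x) (T h))"
      using D has_derivative_unique by blast
    then have "D h = 0 \<longleftrightarrow> (\<forall>k. blinfun_apply (F' (\<psi> x) (T h)) k = 0)"
      by (metis blinfun_eqI blinfun.zero_left)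
    then show "D h = 0 \<longleftrightarrow> T h \<in> mixed_kernel x y"
      using ker by (simp add: mixed_kernel_def)
  qed
qed

section \<open>Level sets as fibres of a submersion and their tangent spaces\<close>

text \<open>By symmetry of the mixed derivatives, a vector \<open>k\<close> orthogonal to the range
  of the derivative satisfies \<open>D2xy AX AY c x y k = 0\<close>. Injectivity forces
  \<open>k = 0\<close>, so the range has trivial orthogonal complement and is the whole
  space.\<close>

lemma riesz_Dy_submersion:
  assumes x: "x \<in> X" and y: "y \<in> Y" and U: "chart_at AX x = (U, \<phi>)"
    and inj: "inj (blinfun_apply (D2xy AX AY c x y))"
  obtains S F' where "open S" "\<phi> x \<in> S" "S \<subseteq> \<phi> ` U"
    "\<And>u. u \<in> S \<Longrightarrow> ((\<lambda>u. riesz (Dy AY c (inv_into U \<phi> u) y)) has_derivative blinfun_apply (F' u)) (at u)"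
    "continuous_on S F'" "surj (blinfun_apply (F' (\<phi> x)))"
    "\<And>h. F' (\<phi> x) h = 0 \<longleftrightarrow> h \<in> mixed_kernel x y"
proof -
  obtain S F' where S: "open S" "\<phi> x \<in> S" "S \<subseteq> \<phi> ` U"
    and F': "\<And>u. u \<in> S \<Longrightarrow> ((\<lambda>u. Dy AY c (inv_into U \<phi> u) y) has_derivative blinfun_apply (F' u)) (at u)"
    and cont: "continuous_on S F'"
    and ker: "\<And>h k. blinfun_apply (blinfun_apply (F' (\<phi> x)) h) k = blinfun_apply (blinfun_apply (D2xy AX AY c x y) k) h"
    by (rule Dy_derivative[OF x y chart_at_mem[OF X x U]]) (use U in blast)
  show ?thesis
  proof (rule that[of S "\<lambda>u. riesz o\<^sub>L F' u"])
    show "((\<lambda>u. riesz (Dy AY c (inv_into U \<phi> u) y)) has_derivative blinfun_apply (riesz o\<^sub>L F' u)) (at u)"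
      if "u \<in> S" for u
      using bounded_linear.has_derivative[OF blinfun.bounded_linear_right[of riesz] F'[OF that]]
      by (simp add: blinfun_compose.rep_eq o_def)
    show "continuous_on S (\<lambda>u. riesz o\<^sub>L F' u)" using cont by (intro continuous_intros)
    show "(riesz o\<^sub>L F' (\<phi> x)) h = 0 \<longleftrightarrow> h \<in> mixed_kernel x y" for h
    proof -
      have "(riesz o\<^sub>L F' (\<phi> x)) h = 0 \<longleftrightarrow> (\<forall>k. riesz (F' (\<phi> x) h) \<bullet> k = 0)"
        using vector_eq_rdot[of "riesz (F' (\<phi> x) h)" 0] by auto
      then show ?thesis by (simp add: inner_riesz ker mixed_kernel_def)
    qed
    let ?R = "range (blinfun_apply (riesz o\<^sub>L F' (\<phi> x)))"
    have "subspace ?R"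
      using blinfun.bounded_linear_right bounded_linear.linear linear_subspace_image subspace_UNIV by blast
    moreover have "?R\<^sup>\<bottom> = {0}"
    proof -
      have "k = 0" if "\<And>h. riesz (F' (\<phi> x) h) \<bullet> k = 0" for k
      proof -
        have "D2xy AX AY c x y k = 0"
          using that by (intro blinfun_eqI) (simp add: inner_riesz ker)
        then show ?thesis
          by (metis blinfun.zero_right inj injD)
      qed
      then show ?thesis by (auto simp: orthogonal_comp_def orthogonal_def)
    qed
    ultimately have "?R = {0}\<^sup>\<bottom>" using orthogonal_comp_self by metis
    then show "surj (blinfun_apply (riesz o\<^sub>L F' (\<phi> x)))"
      by (auto simp: orthogonal_comp_def orthogonal_def)
  qed (use S in auto)
qed

lemma level_set_iff:
  "x' \<in> level_set X AY c x y \<longleftrightarrow> x' \<in> X \<and> riesz (Dy AY c x' y) = riesz (Dy AY c x y)"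
  by (auto simp: level_set_def dest: injD[OF inj_riesz])

text \<open>\<open>F\<close> is constant along a curve in the level set, so its velocity lies in the
  kernel of the derivative. Conversely, for \<open>v\<close> in the kernel, the line through
  \<open>G (\<phi> x)\<close> in direction \<open>v\<close> is carried by \<open>H\<close> into the
  level set, with velocity \<open>v\<close> at time 0 because
  \<open>H' (G (\<phi> x)) = id\<close>.\<close>

lemma tangent_space_level_set:
  assumes x: "x \<in> X" and y: "y \<in> Y"
    and inj: "inj (blinfun_apply (D2xy AX AY c x y))"
  shows "tangent_space AX (level_set X AY c x y) x = mixed_kernel x y"
proof -
  obtain U \<phi> where cU: "chart_at AX x = (U, \<phi>)" by fastforce
  note U = chart_at_mem[OF X x cU]
  note fU = chart_facts[OF X U(1)]
  define F where "F u = riesz (Dy AY c (inv_into U \<phi> u) y)" for u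
  obtain S F' where S: "open S" "\<phi> x \<in> S" "S \<subseteq> \<phi> ` U"
    and F': "\<And>u. u \<in> S \<Longrightarrow> (F has_derivative blinfun_apply (F' u)) (at u)"
    and cont: "continuous_on S F'" and surj: "surj (blinfun_apply (F' (\<phi> x)))"
    and ker: "\<And>h. F' (\<phi> x) h = 0 \<longleftrightarrow> h \<in> mixed_kernel x y"
    unfolding F_def by (rule riesz_Dy_submersion[OF x y cU inj]) blast
  show ?thesis
  proof (intro equalityI subsetI)
    fix v assume "v \<in> tangent_space AX (level_set X AY c x y) x"
    then obtain \<gamma> \<epsilon> where \<gamma>: "\<epsilon> > 0" "\<gamma> 0 = x" "\<gamma> ` {-\<epsilon><..<\<epsilon>} \<subseteq> level_set X AY c x y \<inter> U"
      "((\<phi> \<circ> \<gamma>) has_vector_derivative v) (at (0::real))"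
      unfolding tangent_space_def cU by auto
    have d: "((\<phi> \<circ> \<gamma>) has_derivative (\<lambda>t. t *\<^sub>R v)) (at 0)"
      using \<gamma>(4) by (simp add: has_vector_derivative_def)
    have "(F has_derivative blinfun_apply (F' (\<phi> x))) (at ((\<phi> \<circ> \<gamma>) 0))"
      using F'[OF S(2)] \<gamma>(2) by simp
    from has_derivative_compose[where g=F, OF d this]
    have d1: "((\<lambda>t. F ((\<phi> \<circ> \<gamma>) t)) has_derivative (\<lambda>t. F' (\<phi> x) (t *\<^sub>R v))) (at 0)" .
    have "((\<lambda>t::real. F (\<phi> x)) has_derivative (\<lambda>t. F' (\<phi> x) (t *\<^sub>R v))) (at 0)"
    proof (rule has_derivative_transform_within_open[OF d1, of "{-\<epsilon><..<\<epsilon>}"])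
      fix t assume "t \<in> {-\<epsilon><..<\<epsilon>}"
      then have "\<gamma> t \<in> level_set X AY c x y" "\<gamma> t \<in> U" using \<gamma>(3) by auto
      then show "F ((\<phi> \<circ> \<gamma>) t) = F (\<phi> x)" using fU(6) U(2) by (simp add: F_def level_set_iff)
    qed (use \<gamma>(1) in auto)
    then have "(\<lambda>t. F' (\<phi> x) (t *\<^sub>R v)) = (\<lambda>t. 0)"
      using has_derivative_const has_derivative_unique by blast
    then have "F' (\<phi> x) (1 *\<^sub>R v) = 0" by metis
    then show "v \<in> mixed_kernel x y" using ker by simp
  next
    fix v assume v: "v \<in> mixed_kernel x y"
    obtain G H H' N V where N: "open N" "N \<subseteq> S" "\<phi> x \<in> N" "open V" "homeomorphism N V G H"
      and H: "\<And>w. w \<in> V \<Longrightarrow> (H has_derivative H' w) (at w)"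
      and H'c: "\<And>k. continuous_on V (\<lambda>w. H' w k)"
      and H'0: "H' (G (\<phi> x)) = id"
      and AG: "\<And>u. u \<in> N \<Longrightarrow> F' (\<phi> x) (G u) = F u"
      using submersion_straightening[OF S(1,2) F' cont surj] by metis
    let ?w = "G (\<phi> x)"
    have HG: "H ?w = \<phi> x" "?w \<in> V" using N(3,5) by (auto simp: homeomorphism_def)
    obtain r where r: "r > 0" "ball ?w r \<subseteq> V" using N(4) HG(2) openE by blast
    \<comment> \<open>For times below \<epsilon> in absolute value the line stays in the ball of
      radius \<open>r\<close>; the added 1 covers \<open>v = 0\<close>.\<close>
    define \<epsilon> where "\<epsilon> = r / (norm v + 1)"
    have pos: "norm v + 1 > 0" by (smt (verit) norm_ge_zero)
    then have \<epsilon>: "\<epsilon> > 0" using r(1) by (simp add: \<epsilon>_def)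
    define p where "p t = ?w + t *\<^sub>R v" for t :: real
    have pV: "p t \<in> V" if "t \<in> {-\<epsilon><..<\<epsilon>}" for t
    proof -
      have "norm (t *\<^sub>R v) \<le> \<bar>t\<bar> * (norm v + 1)" by (simp add: mult_left_mono)
      also have "\<dots> < \<epsilon> * (norm v + 1)" using that pos by (intro mult_strict_right_mono) auto
      also have "\<dots> = r" using pos by (simp add: \<epsilon>_def)
      finally show ?thesis using r(2) by (auto simp: p_def dist_norm)
    qed
    define \<gamma> where "\<gamma> t = inv_into U \<phi> (H (p t))" for t
    have HN: "H w \<in> N" if "w \<in> V" for w using N(5) that by (auto simp: homeomorphism_def)
    have HU: "\<exists>x'\<in>U. H (p t) = \<phi> x'" if "t \<in> {-\<epsilon><..<\<epsilon>}" for t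
      using HN[OF pV[OF that]] N(2) S(3) by blast
    have \<phi>\<gamma>: "(\<phi> \<circ> \<gamma>) t = H (p t)" "\<gamma> t \<in> U" if "t \<in> {-\<epsilon><..<\<epsilon>}" for t
      using HU[OF that] fU(6) by (auto simp: \<gamma>_def)
    have FH: "F (H (p t)) = F (\<phi> x)" if "t \<in> {-\<epsilon><..<\<epsilon>}" for t
    proof -
      have "G (H (p t)) = p t" using pV[OF that] N(5) by (auto simp: homeomorphism_def)
      then have "F (H (p t)) = F' (\<phi> x) (p t)" using AG[OF HN[OF pV[OF that]]] by simp
      also have "\<dots> = F (\<phi> x)" using AG[OF N(3)] v ker by (simp add: p_def blinfun.bilinear_simps)
      finally show ?thesis .
    qed
    have der: "((\<phi> \<circ> \<gamma>) has_derivative (\<lambda>s. H' (p t) (s *\<^sub>R v))) (at t)" if t: "t \<in> {-\<epsilon><..<\<epsilon>}" for t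
    proof (rule has_derivative_transform_within_open)
      have "(p has_derivative (\<lambda>s. s *\<^sub>R v)) (at t)"
        unfolding p_def[abs_def] by (auto intro!: derivative_eq_intros)
      from has_derivative_compose[OF this H[OF pV[OF t]]]
      show "((\<lambda>t. H (p t)) has_derivative (\<lambda>s. H' (p t) (s *\<^sub>R v))) (at t)" .
      show "t \<in> {-\<epsilon><..<\<epsilon>}" by fact
    qed (use \<phi>\<gamma> in auto)
    have 0: "(0::real) \<in> {-\<epsilon><..<\<epsilon>}" using \<epsilon> by simp
    have "\<gamma> 0 = x" using HG fU(6) U(2) by (simp add: \<gamma>_def p_def)
    moreover have "\<gamma> ` {-\<epsilon><..<\<epsilon>} \<subseteq> level_set X AY c x y \<inter> U"
    proof -
      have "\<gamma> t \<in> level_set X AY c x y \<inter> U" if "t \<in> {-\<epsilon><..<\<epsilon>}" for t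
        using \<phi>\<gamma>(2)[OF that] FH[OF that] fU(1) fU(6)[OF U(2)]
        by (auto simp: level_set_iff F_def \<gamma>_def)
      then show ?thesis by blast
    qed
    \<comment> \<open>The derivative of the curve at \<open>t\<close> in direction \<open>s\<close>
      is \<open>H' (p t) (s *\<^sub>R v)\<close>, so directionwise continuity of \<open>H'\<close>
      suffices.\<close>
    moreover have "Ck_on 1 {-\<epsilon><..<\<epsilon>} (\<phi> \<circ> \<gamma>)"
    proof -
      have "continuous_on {-\<epsilon><..<\<epsilon>} (\<lambda>t. frechet_derivative (\<phi> \<circ> \<gamma>) (at t) s)" for s
      proof (rule continuous_on_eq)
        show "continuous_on {-\<epsilon><..<\<epsilon>} (\<lambda>t. H' (p t) (s *\<^sub>R v))"
          using pV by (intro continuous_on_compose2[OF H'c])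
            (auto simp: p_def[abs_def] intro!: continuous_intros)
        show "H' (p t) (s *\<^sub>R v) = frechet_derivative (\<phi> \<circ> \<gamma>) (at t) s" if "t \<in> {-\<epsilon><..<\<epsilon>}" for t
          by (simp add: frechet_derivative_at[OF der[OF that], symmetric])
      qed
      moreover have "\<forall>t\<in>{-\<epsilon><..<\<epsilon>}. (\<phi> \<circ> \<gamma>) differentiable at t"
        using der differentiable_def by blast
      ultimately show ?thesis by simp
    qed
    moreover have "((\<phi> \<circ> \<gamma>) has_vector_derivative v) (at 0)"
      using der[OF 0] H'0 by (simp add: has_vector_derivative_def p_def)
    ultimately show "v \<in> tangent_space AX (level_set X AY c x y) x"
      unfolding tangent_space_def cU using \<epsilon> by auto
  qed
qed

section \<open>c-linearity in terms of the mixed kernel\<close>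

lemma mixed_kernel_eq:
  "mixed_kernel x y = (range (\<lambda>k. riesz (D2xy AX AY c x y k)))\<^sup>\<bottom>"
  by (auto simp: mixed_kernel_def orthogonal_comp_def orthogonal_def inner_riesz)

lemma riesz_D2xy_range:
  assumes inj: "inj (blinfun_apply (D2xy AX AY c x y))"
  shows "subspace (range (\<lambda>k. riesz (D2xy AX AY c x y k)))"
    "dim (range (\<lambda>k. riesz (D2xy AX AY c x y k))) = DIM('f)"
proof -
  have lin: "linear (\<lambda>k. riesz (D2xy AX AY c x y k))"
    by (intro bounded_linear.linear bounded_linear_compose[OF blinfun.bounded_linear_right blinfun.bounded_linear_right])
  show "subspace (range (\<lambda>k. riesz (D2xy AX AY c x y k)))"
    using linear_subspace_image[OF lin subspace_UNIV] .
  have "inj (\<lambda>k. riesz (D2xy AX AY c x y k))"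
    using inj_compose[OF inj_riesz inj] by (simp add: o_def)
  then show "dim (range (\<lambda>k. riesz (D2xy AX AY c x y k))) = DIM('f)"
    by (subst dim_image_eq[OF lin]) auto
qed

lemma Dx_inner_derivative:
  assumes "x \<in> X" "y \<in> Y" "chart_at AY y = (V, \<psi>)"
  shows "((\<lambda>v. Dx AX c x (inv_into V \<psi> v) w) has_derivative (\<lambda>k. D2xy AX AY c x y k w)) (at (\<psi> y))"
  using bounded_linear.has_derivative[OF blinfun.bounded_linear_left Dx_derivative[OF assms]] .

text \<open>A vector orthogonal to \<open>riesz\<close> applied to \<open>V\<close> pairs with
  \<open>Dx AX c x\<close> to a constant on \<open>Y\<close>, so it annihilates the range of
  \<open>D2xy\<close>. Taking complements puts that range, after \<open>riesz\<close>, inside the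
  image of \<open>V\<close>, and equal dimensions make them coincide. The right-hand side does not
  mention \<open>y\<close>.\<close>

lemma looks_c_linear_imp_mixed_kernel:
  assumes x: "x \<in> X" and y: "y \<in> Y" and inj: "inj (blinfun_apply (D2xy AX AY c x y))"
    and V: "subspace V" "dim V = DIM('f)" "Dx AX c x ` Y \<subseteq> (+) p ` V"
  shows "mixed_kernel x y = (riesz ` V)\<^sup>\<bottom>"
proof -
  let ?R = "range (\<lambda>k. riesz (D2xy AX AY c x y k))"
  have V': "subspace (riesz ` V)"
    using blinfun.bounded_linear_right bounded_linear.linear linear_subspace_image V(1) by blast
  obtain U \<psi> where cU: "chart_at AY y = (U, \<psi>)" by fastforce
  note U = chart_at_mem[OF Y y cU]
  note fU = chart_facts[OF Y U(1)]
  have "D2xy AX AY c x y k w = 0" if w: "w \<in> (riesz ` V)\<^sup>\<bottom>" for k w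
  proof -
    have "((\<lambda>v. blinfun_apply p w) has_derivative (\<lambda>k. D2xy AX AY c x y k w)) (at (\<psi> y))"
    proof (rule has_derivative_transform_within_open[OF Dx_inner_derivative[OF x y cU] fU(3)])
      fix v assume "v \<in> \<psi> ` U"
      then have "inv_into U \<psi> v \<in> Y" using fU(1,6) by auto
      then obtain l where l: "l \<in> V" "Dx AX c x (inv_into U \<psi> v) = p + l" using V(3) by blast
      have "blinfun_apply l w = 0"
        using w l(1) by (auto simp: orthogonal_comp_def orthogonal_def inner_riesz)
      then show "Dx AX c x (inv_into U \<psi> v) w = blinfun_apply p w"
        by (simp add: l(2) blinfun.add_left)
    qed (use U(2) in blast)
    from has_derivative_unique[OF this has_derivative_const] show ?thesis by metis
  qed
  then have "(riesz ` V)\<^sup>\<bottom> \<subseteq> ?R\<^sup>\<bottom>"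
    by (auto simp: orthogonal_comp_def orthogonal_def inner_riesz)
  then have "?R\<^sup>\<bottom>\<^sup>\<bottom> \<subseteq> (riesz ` V)\<^sup>\<bottom>\<^sup>\<bottom>"
    by (auto simp: orthogonal_comp_def)
  then have "?R \<subseteq> riesz ` V"
    using orthogonal_comp_self[OF V'] orthogonal_comp_self[OF riesz_D2xy_range(1)[OF inj]] by simp
  then have "?R = riesz ` V"
    using riesz_D2xy_range[OF inj] V' V(2)
    by (intro subspace_dim_equal) (auto simp: dim_riesz_image)
  then show ?thesis by (simp add: mixed_kernel_eq)
qed

text \<open>The flat passes through \<open>Dx AX c x y0\<close> in the directions of the range of
  \<open>D2xy\<close> at \<open>y0\<close>. Pairings with kernel vectors are constant on the
  connected \<open>Y\<close>, so every difference \<open>Dx AX c x y - Dx AX c x y0\<close>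
  annihilates the kernel and lies in that range by the double complement.\<close>

lemma mixed_kernel_imp_looks_c_linear:
  assumes x: "x \<in> X" and y0: "y0 \<in> Y" and inj: "inj (blinfun_apply (D2xy AX AY c x y0))"
    and "connected Y" and ker: "\<And>y. y \<in> Y \<Longrightarrow> mixed_kernel x y = mixed_kernel x y0"
  shows "looks_c_linear AX Y DIM('f) c x"
proof -
  let ?V = "range (blinfun_apply (D2xy AX AY c x y0))"
  have "subspace ?V"
    using blinfun.bounded_linear_right bounded_linear.linear linear_subspace_image subspace_UNIV by blast
  moreover have "dim ?V = DIM('f)"
    using riesz_D2xy_range(2)[OF inj] dim_riesz_image[of ?V] by (simp add: image_image)
  moreover have "Dx AX c x y \<in> (+) (Dx AX c x y0) ` ?V" if y: "y \<in> Y" for y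
  proof -
    have "Dx AX c x y w = Dx AX c x y0 w" if w: "w \<in> mixed_kernel x y0" for w
    proof (rule constant_of_derivative_zero[OF Y \<open>connected Y\<close> _ y y0])
      fix y' U \<psi> assume y': "y' \<in> Y" "chart_at AY y' = (U, \<psi>)"
      have "w \<in> mixed_kernel x y'" using w ker[OF y'(1)] by simp
      then show "((\<lambda>v. Dx AX c x (inv_into U \<psi> v) w) has_derivative (\<lambda>_. 0)) (at (\<psi> y'))"
        using Dx_inner_derivative[OF x y', of w] by (simp add: mixed_kernel_def)
    qed
    then have "riesz (Dx AX c x y - Dx AX c x y0) \<in> (mixed_kernel x y0)\<^sup>\<bottom>"
      by (auto simp: orthogonal_comp_def orthogonal_def inner_commute[of _ "riesz _"] inner_riesz
          blinfun.diff_left)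
    then have "riesz (Dx AX c x y - Dx AX c x y0) \<in> range (\<lambda>k. riesz (D2xy AX AY c x y0 k))"
      by (simp add: mixed_kernel_eq orthogonal_comp_self[OF riesz_D2xy_range(1)[OF inj]])
    then obtain k where "Dx AX c x y - Dx AX c x y0 = D2xy AX AY c x y0 k"
      using injD[OF inj_riesz] by blast
    then have "Dx AX c x y = Dx AX c x y0 + D2xy AX AY c x y0 k" by (simp add: diff_eq_eq add.commute)
    then show ?thesis by blast
  qed
  ultimately show ?thesis unfolding looks_c_linear_def by blast
qed

text \<open>Over the empty set only the existence of a subspace of the required dimension is at
  stake, and the inequality of dimensions provides it.\<close>

lemma looks_c_linear_empty:
  assumes "DIM('f) \<le> DIM('e)"
  shows "looks_c_linear AX {} DIM('f) c x"
proof -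
  obtain W :: "'e set" where W: "subspace W" "dim W = DIM('f)"
    using choose_subspace_of_subspace[of "DIM('f)" "UNIV :: 'e set"] assms by auto
  have lin: "linear (blinfun_apply riesz :: ('e \<Rightarrow>\<^sub>L real) \<Rightarrow> 'e)"
    using blinfun.bounded_linear_right bounded_linear.linear by blast
  let ?V = "blinfun_apply riesz -` W"
  have "subspace ?V" using linear_subspace_vimage[OF lin W(1)] .
  moreover have "dim ?V = DIM('f)"
    using dim_riesz_image[of ?V] W(2) by (simp add: surj_riesz)
  ultimately show ?thesis unfolding looks_c_linear_def by blast
qed

lemma looks_c_linear_iff:
  assumes "x \<in> X" "connected Y" "DIM('f) \<le> DIM('e)"
    and "\<And>y. y \<in> Y \<Longrightarrow> inj (blinfun_apply (D2xy AX AY c x y))"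
  shows "looks_c_linear AX Y DIM('f) c x \<longleftrightarrow> (\<forall>y0\<in>Y. \<forall>y1\<in>Y. mixed_kernel x y0 = mixed_kernel x y1)"
proof
  assume "looks_c_linear AX Y DIM('f) c x"
  then show "\<forall>y0\<in>Y. \<forall>y1\<in>Y. mixed_kernel x y0 = mixed_kernel x y1"
    unfolding looks_c_linear_def using looks_c_linear_imp_mixed_kernel assms(1,4) by metis
next
  assume ker: "\<forall>y0\<in>Y. \<forall>y1\<in>Y. mixed_kernel x y0 = mixed_kernel x y1"
  show "looks_c_linear AX Y DIM('f) c x"
  proof (cases "Y = {}")
    case True
    then show ?thesis using looks_c_linear_empty[OF assms(3)] by simp
  next
    case False
    then obtain y0 where "y0 \<in> Y" by blast
    then show ?thesis
      using mixed_kernel_imp_looks_c_linear[OF assms(1) _ assms(4,2)] ker by blast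
  qed
qed

section \<open>Independence of the level sets from y\<close>

text \<open>In straightened coordinates, nearby points with the same value of \<open>F\<close> are
  joined by a segment that \<open>H\<close> maps into the level set. Its velocity lies in the kernel
  for \<open>y0\<close>, hence in that for \<open>y1\<close>, so \<open>E\<close> is constant along
  the resulting curve.\<close>

lemma Dy_locally_constant_on_level_set:
  assumes x: "x \<in> X" and y0: "y0 \<in> Y" and y1: "y1 \<in> Y"
    and inj: "inj (blinfun_apply (D2xy AX AY c x y0))"
    and ker: "\<And>x. x \<in> X \<Longrightarrow> mixed_kernel x y0 = mixed_kernel x y1"
  shows "\<forall>\<^sub>F x' in at x within level_set X AY c x y0. Dy AY c x y1 = Dy AY c x' y1"
proof -
  obtain U \<phi> where cU: "chart_at AX x = (U, \<phi>)" by fastforce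
  note U = chart_at_mem[OF X x cU]
  note fU = chart_facts[OF X U(1)]
  define F where "F u = riesz (Dy AY c (inv_into U \<phi> u) y0)" for u
  define E where "E u = Dy AY c (inv_into U \<phi> u) y1" for u
  obtain S0 F' where S0: "open S0" "\<phi> x \<in> S0" "S0 \<subseteq> \<phi> ` U"
    and F'0: "\<And>u. u \<in> S0 \<Longrightarrow> (F has_derivative blinfun_apply (F' u)) (at u)"
    and cont0: "continuous_on S0 F'" and surj: "surj (blinfun_apply (F' (\<phi> x)))"
    unfolding F_def by (rule riesz_Dy_submersion[OF x y0 cU inj]) blast
  \<comment> \<open>\<open>riesz_Dy_submersion\<close> describes the kernel only at
    \<open>\<phi> x\<close>; this identifies \<open>F'\<close> at every point of \<open>S0\<close>,
    as needed along the curve.\<close>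
  have dF: "F' u h = riesz (D h)"
    if "u \<in> S0" and D: "((\<lambda>u. Dy AY c (inv_into U \<phi> u) y0) has_derivative D) (at u)" for u D h
  proof -
    have "(F has_derivative (\<lambda>h. riesz (D h))) (at u)"
      unfolding F_def[abs_def] by (rule bounded_linear.has_derivative[OF blinfun.bounded_linear_right D])
    from has_derivative_unique[OF F'0[OF \<open>u \<in> S0\<close>] this] show ?thesis by (rule fun_cong)
  qed
  obtain S1 E' where S1: "open S1" "\<phi> x \<in> S1" "S1 \<subseteq> \<phi> ` U"
    and E': "\<And>u. u \<in> S1 \<Longrightarrow> (E has_derivative blinfun_apply (E' u)) (at u)"
    unfolding E_def by (rule Dy_derivative[OF x y1 U]) blast
  define S where "S = S0 \<inter> S1"
  have S: "open S" "\<phi> x \<in> S" "S \<subseteq> S0" "S \<subseteq> S1" using S0 S1 by (auto simp: S_def)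
  have F': "(F has_derivative blinfun_apply (F' u)) (at u)" if "u \<in> S" for u
    using F'0 S(3) that by blast
  obtain G H H' N V where N: "open N" "N \<subseteq> S" "\<phi> x \<in> N" "open V" "homeomorphism N V G H"
    and H: "\<And>w. w \<in> V \<Longrightarrow> (H has_derivative H' w) (at w)"
    and AG: "\<And>u. u \<in> N \<Longrightarrow> F' (\<phi> x) (G u) = F u"
    using submersion_straightening[OF S(1,2) F' continuous_on_subset[OF cont0 S(3)] surj] by metis
  let ?w = "G (\<phi> x)"
  have HN: "H w \<in> N" "G (H w) = w" if "w \<in> V" for w using N(5) that by (auto simp: homeomorphism_def)
  have HG: "H (G u) = u" "G u \<in> V" if "u \<in> N" for u using N(5) that by (auto simp: homeomorphism_def)
  obtain r where r: "r > 0" "ball ?w r \<subseteq> V" using N(4) HG(2)[OF N(3)] openE by blast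
  \<comment> \<open>Convexity of the ball keeps the segment from \<open>?w\<close> to
    \<open>G u\<close> inside \<open>V\<close>.\<close>
  define B where "B = G -` ball ?w r \<inter> N"
  have B: "open B" "\<phi> x \<in> B"
    unfolding B_def using N(1,3,5) r(1) continuous_on_open_vimage[OF N(1)]
    by (auto simp: homeomorphism_def)
  have const: "E u = E (\<phi> x)" if u: "u \<in> B" "F u = F (\<phi> x)" for u
  proof -
    define p where "p t = ?w + t *\<^sub>R (G u - ?w)" for t :: real
    have uN: "u \<in> N" "G u \<in> ball ?w r" using u by (auto simp: B_def)
    have pV: "p t \<in> V" if "t \<in> {0..1}" for t
    proof -
      have "norm (t *\<^sub>R (G u - ?w)) \<le> 1 * norm (G u - ?w)"
        using that unfolding norm_scaleR by (intro mult_right_mono) auto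
      also have "\<dots> < r" using uN(2) by (simp add: dist_norm norm_minus_commute)
      finally show ?thesis using r(2) by (auto simp: p_def dist_norm)
    qed
    \<comment> \<open>An open set of times containing the unit interval, so that derivatives at its
      endpoints are two-sided.\<close>
    define I where "I = p -` V"
    have "open I"
      unfolding I_def p_def[abs_def] by (intro open_vimage N(4) continuous_intros)
    have HpS: "H (p t) \<in> S" if "t \<in> I" for t using HN(1) that N(2) unfolding I_def by blast
    have Fp: "F (H (p t)) = F (\<phi> x)" if "t \<in> I" for t
    proof -
      have pt: "p t \<in> V" using that by (simp add: I_def)
      have "F (H (p t)) = F' (\<phi> x) (p t)" using AG[OF HN(1)[OF pt]] HN(2)[OF pt] by simp
      also have "\<dots> = F (\<phi> x)"
        using AG[OF N(3)] AG[OF uN(1)] u(2) by (simp add: p_def blinfun.bilinear_simps)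
      finally show ?thesis .
    qed
    have dE: "((\<lambda>t. E (H (p t))) has_derivative (\<lambda>_. 0)) (at t)" if t: "t \<in> I" for t :: real
    proof -
      let ?h = "\<lambda>s. H' (p t) (s *\<^sub>R (G u - ?w))"
      have dp: "(p has_derivative (\<lambda>s. s *\<^sub>R (G u - ?w))) (at t)"
        unfolding p_def[abs_def] by (auto intro!: derivative_eq_intros)
      have "p t \<in> V" using t by (simp add: I_def)
      from has_derivative_compose[where g=H, OF dp H[OF this]]
      have dH: "((\<lambda>t. H (p t)) has_derivative ?h) (at t)" .
      have "((\<lambda>t. F (H (p t))) has_derivative (\<lambda>s. F' (H (p t)) (?h s))) (at t)"
        by (rule has_derivative_compose[where g=F, OF dH F'[OF HpS[OF t]]])
      then have "((\<lambda>t. F (\<phi> x)) has_derivative (\<lambda>s. F' (H (p t)) (?h s))) (at t)"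
        by (rule has_derivative_transform_within_open[OF _ \<open>open I\<close> t]) (rule Fp)
      from has_derivative_unique[OF this has_derivative_const]
      have F0: "F' (H (p t)) (?h s) = 0" for s by metis
      obtain x' where x': "x' \<in> U" "H (p t) = \<phi> x'"
        using HpS[OF t] S(3) S0(3) by blast
      have "x' \<in> X" using x' fU(1) by blast
      \<comment> \<open>The moving point \<open>H (p t)\<close> is the coordinate of some
        \<open>x'\<close> whose preferred chart need not be \<open>\<phi>\<close>; \<open>T\<close>
        translates both kernels at \<open>x'\<close> into the present chart.\<close>
      then obtain T where T: "\<And>y D h. y \<in> Y \<Longrightarrow>
          ((\<lambda>u. Dy AY c (inv_into U \<phi> u) y) has_derivative D) (at (\<phi> x')) \<Longrightarrow>
          D h = 0 \<longleftrightarrow> T h \<in> mixed_kernel x' y"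
        by (rule Dy_derivative_kernel[OF _ U(1) x'(1)]) blast
      have E0: "E' (H (p t)) (?h s) = 0" for s
      proof -
        obtain R D where "\<phi> x' \<in> R"
          and D: "\<And>u. u \<in> R \<Longrightarrow>
            ((\<lambda>u. Dy AY c (inv_into U \<phi> u) y0) has_derivative blinfun_apply (D u)) (at u)"
          by (rule Dy_derivative[OF \<open>x' \<in> X\<close> y0 U(1) x'(1)]) blast
        note D = D[OF this(1)]
        have "\<phi> x' \<in> S0" "\<phi> x' \<in> S1" using HpS[OF t] x'(2) S by auto
        have "riesz (D (\<phi> x') (?h s)) = riesz 0"
          using F0[of s] dF[OF \<open>\<phi> x' \<in> S0\<close> D] x'(2) by simp
        then have "D (\<phi> x') (?h s) = 0" using injD[OF inj_riesz] by blast
        then have "T (?h s) \<in> mixed_kernel x' y1"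
          using T[OF y0 D] ker[OF \<open>x' \<in> X\<close>] by blast
        then show ?thesis
          using T[OF y1 E'[OF \<open>\<phi> x' \<in> S1\<close>, unfolded E_def[abs_def]]] x'(2) by simp
      qed
      have "((\<lambda>t. E (H (p t))) has_derivative (\<lambda>s. E' (H (p t)) (?h s))) (at t)"
        by (rule has_derivative_compose[where g=E, OF dH E'[OF subsetD[OF S(4) HpS[OF t]]]])
      then show ?thesis by (simp add: E0)
    qed
    have "E (H (p 0)) = E (H (p 1))"
    proof (rule has_derivative_zero_unique[where f="\<lambda>t. E (H (p t))" and s="{0..1::real}"])
      fix t :: real assume "t \<in> {0..1}"
      then have "t \<in> I" using pV by (simp add: I_def)
      from has_derivative_at_withinI[OF dE[OF this]]
      show "((\<lambda>t. E (H (p t))) has_derivative (\<lambda>_. 0)) (at t within {0..1})" .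
    qed auto
    moreover have "H (p 0) = \<phi> x" using HG(1)[OF N(3)] by (simp add: p_def)
    moreover have "H (p 1) = u" using HG(1)[OF uN(1)] by (simp add: p_def)
    ultimately show ?thesis by simp
  qed
  obtain W where W: "open W" "\<phi> -` B \<inter> U = W \<inter> U"
    using fU(4) B(1) by (metis continuous_on_open_invariant Int_commute)
  obtain W' where W': "open W'" "U = X \<inter> W'" using fU(2) by (auto simp: openin_open)
  show ?thesis
    unfolding eventually_at_topological
  proof (intro exI[of _ "W \<inter> W'"] conjI ballI impI)
    show "open (W \<inter> W')" using W W' by blast
    show "x \<in> W \<inter> W'" using W W' B(2) U(2) by auto
    fix x' assume x': "x' \<in> W \<inter> W'" "x' \<in> level_set X AY c x y0"
    then have "x' \<in> X" by (simp add: level_set_def)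
    then have "x' \<in> U" "\<phi> x' \<in> B" using W(2) W'(2) x'(1) by auto
    moreover have "F (\<phi> x') = F (\<phi> x)"
      using x'(2) fU(6) U(2) \<open>x' \<in> U\<close> by (simp add: F_def level_set_iff)
    ultimately have "E (\<phi> x') = E (\<phi> x)" using const by blast
    then show "Dy AY c x y1 = Dy AY c x' y1"
      using fU(6) U(2) \<open>x' \<in> U\<close> by (simp add: E_def)
  qed
qed

text \<open>Each point \<open>z\<close> of the level set generates the same level set for
  \<open>y0\<close>, so the local constancy of \<open>Dy\<close> in its first argument applies at
  all its points, and connectedness makes it global.\<close>

lemma level_set_subset:
  assumes x: "x \<in> X" and y0: "y0 \<in> Y" and y1: "y1 \<in> Y"
    and inj: "\<And>x. x \<in> X \<Longrightarrow> inj (blinfun_apply (D2xy AX AY c x y0))"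
    and ker: "\<And>x. x \<in> X \<Longrightarrow> mixed_kernel x y0 = mixed_kernel x y1"
    and conn: "connected (level_set X AY c x y0)"
  shows "level_set X AY c x y0 \<subseteq> level_set X AY c x y1"
proof
  fix x' assume x': "x' \<in> level_set X AY c x y0"
  have "Dy AY c x y1 = Dy AY c x' y1"
  proof (rule connected_local_const[OF conn _ x'], goal_cases)
    case 1
    then show ?case using x by (simp add: level_set_def)
  next
    case 2
    show ?case
    proof
      fix z assume "z \<in> level_set X AY c x y0"
      then have z: "z \<in> X" "level_set X AY c z y0 = level_set X AY c x y0"
        by (auto simp: level_set_def)
      show "\<forall>\<^sub>F b in at z within level_set X AY c x y0. Dy AY c z y1 = Dy AY c b y1"
        using Dy_locally_constant_on_level_set[OF z(1) y0 y1 inj[OF z(1)] ker] z(2) by simp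
    qed
  qed
  then show "x' \<in> level_set X AY c x y1" using x' by (simp add: level_set_def)
qed

end

section \<open>The two equivalences\<close>

theorem lemma3p3:
  fixes X :: "'a::{t2_space, second_countable_topology} set"
    and Y :: "'b::{t2_space, second_countable_topology} set"
    and AX :: "('a, 'e::euclidean_space) chart set"
    and AY :: "('b, 'f::euclidean_space) chart set"
    and AM :: "('a, 'p::euclidean_space) chart set"
    and AN :: "('b, 'q::euclidean_space) chart set"
    and c :: "'a \<Rightarrow> 'b \<Rightarrow> real"
    and m n :: nat
  assumes "m = DIM('e)" and "n = DIM('f)" and "m \<ge> n"
    and "smooth_manifold X AX" and "smooth_manifold Y AY"
    and "connected Y"
    and "smooth_manifold UNIV AM" and "smoothly_embedded AX AM" and "compact (closure X)"
    and "smooth_manifold UNIV AN" and "smoothly_embedded AY AN" and "compact (closure Y)"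
    and "Ck_on_product 4 AM AN (closure X) (closure Y) c"
    and "\<forall>x\<in>X. \<forall>y\<in>Y. inj (blinfun_apply (D2xy AX AY c x y))"
  shows "(\<forall>x\<in>X. looks_c_linear AX Y n c x \<longleftrightarrow>
            (\<forall>y0\<in>Y. \<forall>y1\<in>Y. tangent_space AX (level_set X AY c x y0) x
                           = tangent_space AX (level_set X AY c x y1) x))
       \<and> ((\<forall>x\<in>X. \<forall>y\<in>Y. connected (level_set X AY c x y)) \<longrightarrow>
            (c_linear X AX Y n c \<longleftrightarrow>
              (\<forall>x\<in>X. \<forall>y0\<in>Y. \<forall>y1\<in>Y. level_set X AY c x y0 = level_set X AY c x y1)))"
proof -
  have "Ck_on_product (Suc (Suc 2)) AM AN (closure X) (closure Y) c"
    using assms(13) by (simp add: numeral_eq_Suc)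
  then interpret cost_on_manifolds X Y AX AY AM AN c 2
    using assms by unfold_locales auto
  have inj: "inj (blinfun_apply (D2xy AX AY c x y))" if "x \<in> X" "y \<in> Y" for x y
    using assms(14) that by blast
  have tangent: "tangent_space AX (level_set X AY c x y) x = mixed_kernel x y" if "x \<in> X" "y \<in> Y" for x y
    using tangent_space_level_set[OF that inj[OF that]] .
  have linear: "looks_c_linear AX Y n c x \<longleftrightarrow> (\<forall>y0\<in>Y. \<forall>y1\<in>Y. mixed_kernel x y0 = mixed_kernel x y1)"
    if "x \<in> X" for x
    unfolding assms(2) using looks_c_linear_iff[OF that assms(6)] assms(1-3) inj[OF that] by simp
  show ?thesis
  proof (intro conjI ballI impI)
    fix x assume "x \<in> X"
    then show "looks_c_linear AX Y n c x \<longleftrightarrow>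
            (\<forall>y0\<in>Y. \<forall>y1\<in>Y. tangent_space AX (level_set X AY c x y0) x
                           = tangent_space AX (level_set X AY c x y1) x)"
      by (simp add: linear tangent)
  next
    assume conn: "\<forall>x\<in>X. \<forall>y\<in>Y. connected (level_set X AY c x y)"
    show "c_linear X AX Y n c \<longleftrightarrow>
        (\<forall>x\<in>X. \<forall>y0\<in>Y. \<forall>y1\<in>Y. level_set X AY c x y0 = level_set X AY c x y1)"
    proof
      assume "c_linear X AX Y n c"
      then have ker: "mixed_kernel x y0 = mixed_kernel x y1" if "x \<in> X" "y0 \<in> Y" "y1 \<in> Y" for x y0 y1
        using that linear unfolding c_linear_def by blast
      \<comment> \<open>The inclusion holds for every ordered pair of points of \<open>Y\<close>;
        exchanging them gives equality.\<close>
      have "level_set X AY c x y0 \<subseteq> level_set X AY c x y1" if "x \<in> X" "y0 \<in> Y" "y1 \<in> Y" for x y0 y1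
        by (rule level_set_subset[OF that inj[OF _ that(2)] ker[OF _ that(2,3)]]) (use that conn in blast)+
      then show "\<forall>x\<in>X. \<forall>y0\<in>Y. \<forall>y1\<in>Y. level_set X AY c x y0 = level_set X AY c x y1"
        by blast
    next
      assume "\<forall>x\<in>X. \<forall>y0\<in>Y. \<forall>y1\<in>Y. level_set X AY c x y0 = level_set X AY c x y1"
      \<comment> \<open>Equal level sets have equal tangent spaces at \<open>x\<close>, and these
        are the mixed kernels.\<close>
      then have "mixed_kernel x y0 = mixed_kernel x y1" if "x \<in> X" "y0 \<in> Y" "y1 \<in> Y" for x y0 y1
        using tangent that by metis
      then show "c_linear X AX Y n c"
        unfolding c_linear_def using linear by blast
    qed
  qed
qed

end
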